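(* For each constant $q\ge 3$, PCP restricted to instances with $k=1$ and maximum part size $q$ is NP-complete.
   Context: The Partition Coloring Problem (PCP): given a simple undirected graph $G=(V,E)$, a partition $\mathcal{V}=\{V_1,\dots,V_p\}$ of $V$ into pairwise disjoint parts whose union is $V$, and an integer $k$ (the number of colors), decide whether there is a selection $S$ of $\mathcal{V}$ (a set $S\subseteq V$ with $|S\cap V_i|=1$ for every $i$) such that $\chi(G[S])\le k$. Here $q=\max_{1\le i\le p}|V_i|$ is the maximum part size (parts have at most $q$ vertices). *)

theory Defs
  imports
    "HOL-Library.Disjoint_Sets"
    "HOL-Computational_Algebra.Polynomial"
begin

section \<open>Deterministic multi-tape Turing machines\<close>

datatype direction = Move_Left | Stay | Move_Right

text \<open>
  Tapes are infinite in both directions; a tape is given by its cell contents and its head position.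
  Tape symbols are natural numbers: \<open>0\<close> is the blank, \<open>1\<close> and \<open>2\<close> are the two input symbols,
  and a machine may use further symbols below its alphabet size.
\<close>

type_synonym tape = "(int \<Rightarrow> nat) \<times> int"
type_synonym config = "nat \<times> tape list"

text \<open>
  A command is the row of the transition table for one state: from the symbols under the heads it
  yields the next state and, per tape, the symbol to write and the head movement.
  The states of a machine \<open>M\<close> are \<open>0, \<dots>, length M\<close>; \<open>0\<close> is the initial
  state and \<open>length M\<close> is the halting state.
\<close>

type_synonym command = "nat list \<Rightarrow> nat \<times> (nat \<times> direction) list"
type_synonym machine = "command list"

definition turing_machine :: "nat \<Rightarrow> nat \<Rightarrow> machine \<Rightarrow> bool" where
  "turing_machine k g M \<longleftrightarrow> 2 \<le> k \<and> 3 \<le> g \<and>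
     (\<forall>\<delta>\<in>set M. \<forall>rs. length rs = k \<and> set rs \<subseteq> {..<g} \<longrightarrow>
        (case \<delta> rs of (s, as) \<Rightarrow>
           s \<le> length M \<and> length as = k \<and> fst ` set as \<subseteq> {..<g}))"

fun offset :: "direction \<Rightarrow> int" where
  "offset Move_Left = -1"
| "offset Stay = 0"
| "offset Move_Right = 1"

definition read_tape :: "tape \<Rightarrow> nat" where
  "read_tape t = fst t (snd t)"

fun act :: "nat \<times> direction \<Rightarrow> tape \<Rightarrow> tape" where
  "act (a, d) (c, h) = (c(h := a), h + offset d)"

text \<open>Halting configurations are fixed points of the step function.\<close>

fun step :: "machine \<Rightarrow> config \<Rightarrow> config" where
  "step M (s, ts) =
     (if s < length M
      then (case (M ! s) (map read_tape ts) of (s', as) \<Rightarrow> (s', map2 act as ts))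
      else (s, ts))"

definition contents :: "bool list \<Rightarrow> int \<Rightarrow> nat" where
  "contents x i =
     (if 0 \<le> i \<and> i < int (length x) then (if x ! nat i then 2 else 1) else 0)"

text \<open>The input is on tape \<open>0\<close>; all other tapes are blank. The output is read off tape \<open>1\<close>.\<close>

definition init_config :: "nat \<Rightarrow> bool list \<Rightarrow> config" where
  "init_config k x = (0, (contents x, 0) # replicate (k - 1) (contents [], 0))"

definition computes_within :: "nat \<Rightarrow> machine \<Rightarrow> nat \<Rightarrow> bool list \<Rightarrow> bool list \<Rightarrow> bool" where
  "computes_within k M t x y \<longleftrightarrow>
     (case (step M ^^ t) (init_config k x) of (s, ts) \<Rightarrow>
        s = length M \<and> fst (ts ! 1) = contents y)"


section \<open>Polynomial time and NP\<close>

definition polytime :: "(bool list \<Rightarrow> bool list) \<Rightarrow> bool" where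
  "polytime f \<longleftrightarrow> (\<exists>k g M. \<exists>p :: nat poly. turing_machine k g M \<and>
     (\<forall>x. computes_within k M (poly p (length x)) x (f x)))"

definition class_P :: "bool list set set" where
  "class_P = {L. polytime (\<lambda>x. [x \<in> L])}"

text \<open>Every bit of the first component is preceded by a marker \<open>True\<close>, so the pairing is injective.\<close>

definition encode_pair :: "bool list \<Rightarrow> bool list \<Rightarrow> bool list" where
  "encode_pair x w = concat (map (\<lambda>b. [True, b]) x) @ False # w"

definition class_NP :: "bool list set set" where
  "class_NP = {L. \<exists>R\<in>class_P. \<exists>p :: nat poly.
     \<forall>x. x \<in> L \<longleftrightarrow> (\<exists>w. length w \<le> poly p (length x) \<and> encode_pair x w \<in> R)}"

definition polytime_reducible :: "bool list set \<Rightarrow> bool list set \<Rightarrow> bool" where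
  "polytime_reducible L L' \<longleftrightarrow> (\<exists>f. polytime f \<and> (\<forall>x. x \<in> L \<longleftrightarrow> f x \<in> L'))"

definition NP_hard :: "bool list set \<Rightarrow> bool" where
  "NP_hard L \<longleftrightarrow> (\<forall>L'\<in>class_NP. polytime_reducible L' L)"

definition NP_complete :: "bool list set \<Rightarrow> bool" where
  "NP_complete L \<longleftrightarrow> L \<in> class_NP \<and> NP_hard L"


section \<open>The partition coloring problem\<close>

definition simple_graph :: "'a set \<Rightarrow> 'a set set \<Rightarrow> bool" where
  "simple_graph V E \<longleftrightarrow> finite V \<and> (\<forall>e\<in>E. e \<subseteq> V \<and> card e = 2)"

definition induced_edges :: "'a set set \<Rightarrow> 'a set \<Rightarrow> 'a set set" where
  "induced_edges E S = {e \<in> E. e \<subseteq> S}"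

definition proper_coloring :: "'a set \<Rightarrow> 'a set set \<Rightarrow> nat \<Rightarrow> ('a \<Rightarrow> nat) \<Rightarrow> bool" where
  "proper_coloring V E k c \<longleftrightarrow>
     c ` V \<subseteq> {..<k} \<and> (\<forall>u v. {u, v} \<in> E \<longrightarrow> c u \<noteq> c v)"

definition chromatic_number :: "'a set \<Rightarrow> 'a set set \<Rightarrow> nat" where
  "chromatic_number V E = (LEAST k. \<exists>c. proper_coloring V E k c)"

definition selection :: "'a set \<Rightarrow> 'a set set \<Rightarrow> 'a set \<Rightarrow> bool" where
  "selection V P S \<longleftrightarrow> S \<subseteq> V \<and> (\<forall>A\<in>P. card (S \<inter> A) = 1)"

definition pcp_instance :: "'a set \<Rightarrow> 'a set set \<Rightarrow> 'a set set \<Rightarrow> bool" where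
  "pcp_instance V E P \<longleftrightarrow> simple_graph V E \<and> partition_on V P"

definition pcp_solvable :: "'a set \<Rightarrow> 'a set set \<Rightarrow> 'a set set \<Rightarrow> nat \<Rightarrow> bool" where
  "pcp_solvable V E P k \<longleftrightarrow>
     (\<exists>S. selection V P S \<and> chromatic_number S (induced_edges E S) \<le> k)"

text \<open>The maximum of the empty family of parts is unspecified, hence the first conjunct.\<close>

definition has_max_part_size :: "'a set set \<Rightarrow> nat \<Rightarrow> bool" where
  "has_max_part_size P q \<longleftrightarrow> P \<noteq> {} \<and> Max (card ` P) = q"


subsection \<open>Encoding of instances as bit strings\<close>

definition encode_nat :: "nat \<Rightarrow> bool list" where
  "encode_nat n = replicate n True @ [False]"

definition encode_list :: "('a \<Rightarrow> bool list) \<Rightarrow> 'a list \<Rightarrow> bool list" where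
  "encode_list enc xs = concat (map (\<lambda>x. True # enc x) xs) @ [False]"

definition encode_edge :: "nat \<times> nat \<Rightarrow> bool list" where
  "encode_edge e = encode_nat (fst e) @ encode_nat (snd e)"

text \<open>
  An instance on the vertices \<open>0, \<dots>, n - 1\<close> is written down as \<open>n\<close>, \<open>k\<close>, a list of the
  edges and a list of the parts.
\<close>

definition encode_instance ::
    "nat \<Rightarrow> nat \<Rightarrow> (nat \<times> nat) list \<Rightarrow> nat list list \<Rightarrow> bool list" where
  "encode_instance n k es ps =
     encode_nat n @ encode_nat k @ encode_list encode_edge es @
     encode_list (encode_list encode_nat) ps"

definition edge_set :: "(nat \<times> nat) list \<Rightarrow> nat set set" where
  "edge_set es = (\<lambda>(u, v). {u, v}) ` set es"

definition part_set :: "nat list list \<Rightarrow> nat set set" where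
  "part_set ps = set ` set ps"

text \<open>
  The language of yes-instances with \<open>k\<close> colors and maximum part size \<open>q\<close>. The condition
  \<open>distinct (concat ps)\<close> says that the listing of the parts is free of repetitions.
\<close>

definition PCP_restricted :: "nat \<Rightarrow> nat \<Rightarrow> bool list set" where
  "PCP_restricted k q = {encode_instance n k es ps | n es ps.
     distinct (concat ps) \<and>
     pcp_instance {..<n} (edge_set es) (part_set ps) \<and>
     has_max_part_size (part_set ps) q \<and>
     pcp_solvable {..<n} (edge_set es) (part_set ps) k}"

end

theory Submission
  imports Defs "HOL-Library.Nat_Bijection"
begin

text \<open>
  With one color, a selection is admissible iff it is an independent set. Hence a 3-CNF formula
  becomes an instance whose parts are the clauses, whose vertices are the literal occurrences and
  whose edges join complementary literals; an extra part of \<open>q\<close> isolated vertices makes the maximum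
  part size equal to \<open>q\<close>. The formulas come directly from the tableau of a verifier. Its clauses
  are implications with at most two premises that propagate the facts of a run from time \<open>t\<close> to
  time \<open>t + 1\<close>: the symbols under the heads are collected tape by tape, so that no clause mentions
  all tapes at once. Only the certificate is left open, so a satisfying assignment must contain all
  facts of the run on some certificate.

  Both the verifier for membership in NP and the reduction are written in a small language of
  arithmetic expressions with bounded sums and of output loops over them. Every program in it needs
  only polynomially bounded counters, and a counter is just a head position on a tape.
  The certificate lists the whole instance in a random-access format, so that the verifier compares
  it with the input instead of parsing the input.
\<close>

section \<open>Counter programs\<close>

text \<open>Expressions have sums over ranges but no variables carried from one round to the next.
  That makes substitution, hence composition, immediate and lets polynomial running times follow by
  structural induction, but it leaves no direct way to scan an input with a state. Parsing is such a
  scan; printing is not. Hence the verifier computes the length and the single symbols of the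
  instance that the certificate stands for. The tableau and the conflict graph are nested ranges
  over coordinates too, so the whole reduction is one output program and polynomial-time machines
  never have to be composed.

  No clause says that a cell holds only one symbol or that a head is in only one place. Apart from
  the free certificate cells all clauses are Horn: the facts of a run follow from facts already
  true, whatever else is true. The only purely negative clause forbids the rejecting output, so an
  assignment with surplus facts cannot hide a rejection.\<close>

datatype prim = Inc nat | Dec nat | Inc_If nat nat | Go_Left | Go_Right | Emit bool

datatype prog = Prim prim | Seq prog prog (infixr \<open>;;\<close> 60) | While nat prog

type_synonym store = "(nat \<Rightarrow> nat) \<times> int \<times> bool list"

fun prim_sem :: "bool list \<Rightarrow> prim \<Rightarrow> store \<Rightarrow> store" where
  "prim_sem x (Inc r) (e, h, y) = (e(r := Suc (e r)), h, y)"
| "prim_sem x (Dec r) (e, h, y) = (e(r := e r - 1), h, y)"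
| "prim_sem x (Inc_If a r) (e, h, y) =
     (if contents x h = a then e(r := Suc (e r)) else e, h, y)"
| "prim_sem x Go_Left (e, h, y) = (e, h - 1, y)"
| "prim_sem x Go_Right (e, h, y) = (e, h + 1, y)"
| "prim_sem x (Emit b) (e, h, y) = (e, h, y @ [b])"

text \<open>The counted time is exactly that of the compiled machine: each round of a loop costs one
  step for the test and one for the jump back, and leaving the loop costs the last test.\<close>

inductive exec :: "bool list \<Rightarrow> prog \<Rightarrow> store \<Rightarrow> nat \<Rightarrow> store \<Rightarrow> bool" for x where
  exec_Prim: "exec x (Prim p) s 1 (prim_sem x p s)"
| exec_Seq: "exec x c s t s' \<Longrightarrow> exec x d s' u s'' \<Longrightarrow> exec x (c ;; d) s (t + u) s''"
| exec_While_False: "fst s r = 0 \<Longrightarrow> exec x (While r c) s 1 s"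
| exec_While_True: "fst s r \<noteq> 0 \<Longrightarrow> exec x c s t s' \<Longrightarrow> exec x (While r c) s' u s'' \<Longrightarrow>
    exec x (While r c) s (t + u + 2) s''"

text \<open>
  Counter \<open>r\<close> lives on tape \<open>r + 2\<close>: its value is the head position, and the only nonblank
  symbol of that tape is a \<open>1\<close> in cell \<open>0\<close>, so that a counter is zero iff its head reads \<open>1\<close>.
\<close>

fun prim_act :: "prim \<Rightarrow> nat list \<Rightarrow> nat \<Rightarrow> nat \<times> direction" where
  "prim_act (Inc r) rs i = (rs ! i, if i = r + 2 then Move_Right else Stay)"
| "prim_act (Dec r) rs i = (rs ! i, if i = r + 2 \<and> rs ! i = 0 then Move_Left else Stay)"
| "prim_act (Inc_If a r) rs i = (rs ! i, if i = r + 2 \<and> rs ! 0 = a then Move_Right else Stay)"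
| "prim_act Go_Left rs i = (rs ! i, if i = 0 then Move_Left else Stay)"
| "prim_act Go_Right rs i = (rs ! i, if i = 0 then Move_Right else Stay)"
| "prim_act (Emit b) rs i =
     (if i = 1 then (if b then 2 else 1, Move_Right) else (rs ! i, Stay))"

fun prog_size :: "prog \<Rightarrow> nat" where
  "prog_size (Prim p) = 1"
| "prog_size (c ;; d) = prog_size c + prog_size d"
| "prog_size (While r c) = prog_size c + 2"

text \<open>Only counters tested by a loop determine the number of tapes. A configuration shows the
  first \<open>k\<close> tapes, so changing a counter beyond them is an invisible step.\<close>

fun test_bound :: "prog \<Rightarrow> nat" where
  "test_bound (Prim p) = 0"
| "test_bound (c ;; d) = max (test_bound c) (test_bound d)"
| "test_bound (While r c) = max (Suc r) (test_bound c)"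

definition command :: "nat \<Rightarrow> (nat list \<Rightarrow> nat) \<Rightarrow> (nat list \<Rightarrow> nat \<Rightarrow> nat \<times> direction) \<Rightarrow> command" where
  "command k f A rs = (f rs, map (A rs) [0..<k])"

definition idle :: "nat list \<Rightarrow> nat \<Rightarrow> nat \<times> direction" where
  "idle rs i = (rs ! i, Stay)"

text \<open>\<open>a\<close> is the address of the first command and jump targets are absolute;
  control leaves at \<open>a + prog_size c\<close>. A loop has two commands besides its body: the
  test in front and the jump back behind.\<close>

fun code :: "nat \<Rightarrow> nat \<Rightarrow> prog \<Rightarrow> machine" where
  "code k a (Prim p) = [command k (\<lambda>_. Suc a) (prim_act p)]"
| "code k a (c ;; d) = code k a c @ code k (a + prog_size c) d"
| "code k a (While r c) =
     command k (\<lambda>rs. if rs ! (r + 2) = 0 then Suc a else a + prog_size c + 2) idle #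
     code k (Suc a) c @ [command k (\<lambda>_. a) idle]"

fun tape_of :: "bool list \<Rightarrow> store \<Rightarrow> nat \<Rightarrow> tape" where
  "tape_of x (e, h, y) i =
     (if i = 0 then (contents x, h)
      else if i = 1 then (contents y, int (length y))
      else (\<lambda>z. if z = 0 then 1 else 0, int (e (i - 2))))"

definition conf :: "nat \<Rightarrow> bool list \<Rightarrow> nat \<Rightarrow> store \<Rightarrow> config" where
  "conf k x pc s = (pc, map (tape_of x s) [0..<k])"

section \<open>Simulation of counter programs by machines\<close>

lemma length_code [simp]: "length (code k a c) = prog_size c"
  by (induction c arbitrary: a) auto

lemma map2_map_upt: "map2 f (map g [0..<k]) (map h [0..<k]) = map (\<lambda>i. f (g i) (h i)) [0..<k]"
  by (rule nth_equalityI) auto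

lemma step_conf:
  assumes "pc < length M" "M ! pc = command k f A"
    and "rs = map (\<lambda>i. read_tape (tape_of x s i)) [0..<k]"
    and "\<And>i. i < k \<Longrightarrow> act (A rs i) (tape_of x s i) = tape_of x s' i"
  shows "step M (conf k x pc s) = conf k x (f rs) s'"
  using assms by (auto simp: conf_def command_def map2_map_upt comp_def)

lemma act_idle: "act (read_tape t, Stay) t = t"
  by (cases t) (simp add: read_tape_def)

lemma contents_append: "(contents y)(int (length y) := if b then 2 else 1) = contents (y @ [b])"
  by (auto simp: contents_def nth_append fun_eq_iff nat_less_iff)

text \<open>A command treats the tapes independently, so each is checked alone. Decrementing zero
  agrees with truncated subtraction because the head then reads the marker and stays.\<close>

lemma step_prim:
  assumes "pc < length M" "M ! pc = command k (\<lambda>_. a) (prim_act p)" "2 \<le> k"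
  shows "step M (conf k x pc s) = conf k x a (prim_sem x p s)"
proof -
  obtain e h y where s: "s = (e, h, y)" by (cases s)
  show ?thesis
    apply (rule step_conf[OF assms(1,2) refl])
    using assms(3)
    by (cases p) (auto simp: s act_idle read_tape_def contents_append fun_eq_iff)
qed

lemma step_idle:
  assumes "pc < length M" "M ! pc = command k f idle"
  shows "step M (conf k x pc s) = conf k x (f (map (\<lambda>i. read_tape (tape_of x s i)) [0..<k])) s"
  by (rule step_conf[OF assms refl]) (simp add: idle_def act_idle)

text \<open>The surrounding code \<open>us\<close>, \<open>vs\<close> has to be arbitrary because
  subprograms sit at shifted addresses. Steps are counted exactly, so the two halves of a run
  compose by adding exponents.\<close>

lemma exec_code:
  assumes "exec x c s t s'" "M = us @ code k a c @ vs" "length us = a" "test_bound c + 2 \<le> k"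
  shows "(step M ^^ t) (conf k x a s) = conf k x (a + prog_size c) s'"
  using assms
proof (induction arbitrary: us vs a rule: exec.induct)
  case (exec_Prim p s)
  then show ?case using step_prim[of a M k "Suc a" p x s] by auto
next
  case (exec_Seq c s t s' d u s'')
  have 1: "(step M ^^ t) (conf k x a s) = conf k x (a + prog_size c) s'"
    using exec_Seq.prems by (intro exec_Seq.IH(1)[of us a "code k (a + prog_size c) d @ vs"]) auto
  have 2: "(step M ^^ u) (conf k x (a + prog_size c) s') = conf k x (a + prog_size c + prog_size d)
      s''"
    using exec_Seq.prems by (intro exec_Seq.IH(2)[of "us @ code k a c" _ vs]) auto
  show ?case using 1 2 by (simp add: add.commute[of t] funpow_add add.assoc)
next
  case (exec_While_False s r c)
  then show ?case
    using step_idle[of a M k "\<lambda>rs. if rs ! (r + 2) = 0 then Suc a else a + prog_size c + 2" x s]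
    by (cases s) (auto simp: read_tape_def)
next
  case (exec_While_True s r c t s' u s'')
  have 1: "step M (conf k x a s) = conf k x (Suc a) s"
    using exec_While_True.prems exec_While_True.hyps(1)
      step_idle[of a M k "\<lambda>rs. if rs ! (r + 2) = 0 then Suc a else a + prog_size c + 2" x s]
    by (cases s) (auto simp: read_tape_def)
  have 2: "(step M ^^ t) (conf k x (Suc a) s) = conf k x (Suc a + prog_size c) s'"
    using exec_While_True.prems
    by (intro exec_While_True.IH(1)[of "us @ [command k (\<lambda>rs. if rs ! (r + 2) = 0 then Suc a else a
        + prog_size c + 2) idle]" _
          "command k (\<lambda>_. a) idle # vs"]) auto
  have 3: "step M (conf k x (Suc a + prog_size c) s') = conf k x a s'"
    using exec_While_True.prems
    by (subst step_idle[where f = "\<lambda>_. a" and k = k]) (auto simp: nth_append)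
  have 4: "(step M ^^ u) (conf k x a s') = conf k x (a + prog_size (While r c)) s''"
    using exec_While_True.prems by (intro exec_While_True.IH(2))
  have "(step M ^^ (u + (1 + (t + 1)))) (conf k x a s) = conf k x (a + prog_size (While r c)) s''"
    unfolding funpow_add comp_apply using 1 2 3 4 by simp
  then show ?case by (simp add: add.commute[of u])
qed

lemma turing_machine_code:
  assumes "\<delta> \<in> set (code k a c)" "length rs = k" "set rs \<subseteq> {..<3}" "2 \<le> k"
  shows "case \<delta> rs of (s, as) \<Rightarrow> s \<le> a + prog_size c \<and> length as = k \<and> fst ` set as \<subseteq> {..<3}"
  using assms(1)
proof (induction c arbitrary: a)
  case (Prim p)
  have "rs ! i < 3" if "i < k" for i using that assms(2,3) by (metis lessThan_iff nth_mem subsetD)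
  then show ?case using Prim by (cases p) (auto simp: command_def)
next
  case (Seq c d)
  then show ?case by (fastforce split: prod.splits)
next
  case (While r c)
  have *: "rs ! i < 3" if "i < k" for i using that assms(2,3)
      by (metis lessThan_iff nth_mem subsetD)
  from While.prems consider "\<delta> \<in> set (code k (Suc a) c)"
    | f where "\<delta> = command k f idle" "\<And>rs. f rs \<le> a + prog_size c + 2" by fastforce
  then show ?case
  proof cases
    case 1
    from While.IH[OF this] show ?thesis by (auto split: prod.splits)
  qed (auto simp: command_def idle_def *)
qed

text \<open>A halted machine may be observed at any later time. This turns an upper bound on the
  time into the fixed number of steps that \<open>computes_within\<close> prescribes.\<close>

lemma funpow_step_halted:
  assumes "(step M ^^ t) c = (length M, ts)" "t \<le> t'"
  shows "(step M ^^ t') c = (length M, ts)"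
proof -
  have "(step M ^^ u) (length M, ts) = (length M, ts)" for u
    by (induction u) auto
  then show ?thesis using assms le_Suc_ex[OF assms(2)]
    by (auto simp: add.commute[of t] funpow_add)
qed

lemma polytime_if_exec:
  fixes p :: "nat poly"
  assumes "\<And>x. \<exists>t e h. t \<le> poly p (length x) \<and> exec x c (\<lambda>_. 0, 0, []) t (e, h, f x)"
  shows "polytime f"
proof -
  define k where "k = test_bound c + 2"
  \<comment> \<open>The tapes of the counters start blank, so one additional first step puts the
    marker \<open>1\<close> into cell \<open>0\<close> of each. Hence the code begins at address
    \<open>1\<close> and the time bound grows by one.\<close>
  define A where "A = (\<lambda>rs i. if 2 \<le> i then (1 :: nat, Stay) else idle rs i)"
  define M where "M = command k (\<lambda>_. 1) A # code k 1 c"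
  have k: "2 \<le> k" by (simp add: k_def)
  have "case \<delta> rs of (s, as) \<Rightarrow> s \<le> length M \<and> length as = k \<and> fst ` set as \<subseteq> {..<3}"
    if "\<delta> \<in> set M" "length rs = k" "set rs \<subseteq> {..<3}" for \<delta> rs
  proof (cases "\<delta> = command k (\<lambda>_. 1) A")
    case True
    have "rs ! i < 3" if "i < k" for i using that \<open>length rs = k\<close> \<open>set rs \<subseteq> _\<close>
        by (metis lessThan_iff nth_mem subsetD)
    then show ?thesis unfolding True by (auto simp: command_def M_def A_def idle_def)
  next
    case False
    then show ?thesis using turing_machine_code[of \<delta> k 1 c rs] that k by (auto simp: M_def)
  qed
  then have tm: "turing_machine k 3 M" unfolding turing_machine_def using k by auto
  have "computes_within k M (poly (p + 1) (length x)) x (f x)" for x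
  proof -
    obtain t e h where t: "t \<le> poly p (length x)" and ex: "exec x c (\<lambda>_. 0, 0, []) t (e, h, f x)"
      using assms by blast
    have "init_config k x = (0, map (\<lambda>i. if i = 0 then (contents x, 0) else (contents [], 0))
        [0..<k])"
      unfolding init_config_def using k
      by (auto intro!: nth_equalityI simp: nth_Cons split: nat.splits)
    moreover have "contents [] = (\<lambda>_. 0)" by (auto simp: contents_def)
    ultimately have "step M (init_config k x) = conf k x 1 (\<lambda>_. 0, 0, [])"
      using k by (auto simp: M_def conf_def command_def A_def idle_def read_tape_def map2_map_upt
          comp_def)
    moreover have "(step M ^^ t) (conf k x 1 (\<lambda>_. 0, 0, [])) = conf k x (1 + prog_size c) (e, h, f
        x)"
      by (rule exec_code[OF ex, where us = "[command k (\<lambda>_. 1) A]" and vs =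
          "[]"]) (auto simp: M_def k_def)
    ultimately have "(step M ^^ Suc t) (init_config k x) = conf k x (length M) (e, h, f x)"
      by (simp only: funpow_Suc_right comp_apply) (simp add: M_def)
    moreover have "Suc t \<le> poly (p + 1) (length x)" using t by simp
    ultimately have "(step M ^^ poly (p + 1) (length x)) (init_config k x) = conf k x (length M) (e,
        h, f x)"
      unfolding conf_def by (rule funpow_step_halted)
    then show ?thesis unfolding computes_within_def conf_def using k by simp
  qed
  then show ?thesis unfolding polytime_def using tm by blast
qed

section \<open>Arithmetic expressions and output programs\<close>

datatype expr = Var nat | One | Add expr expr | Sub expr expr | Sum expr expr | Sym nat expr | Len

text \<open>Variables are de Bruijn indices: the body of a sum or loop sees the bound variable as \<open>0\<close>.\<close>

fun eval :: "bool list \<Rightarrow> (nat \<Rightarrow> nat) \<Rightarrow> expr \<Rightarrow> nat" where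
  "eval x \<rho> (Var i) = \<rho> i"
| "eval x \<rho> One = 1"
| "eval x \<rho> (Add a b) = eval x \<rho> a + eval x \<rho> b"
| "eval x \<rho> (Sub a b) = eval x \<rho> a - eval x \<rho> b"
| "eval x \<rho> (Sum a b) = (\<Sum>i<eval x \<rho> a. eval x (case_nat i \<rho>) b)"
| "eval x \<rho> (Sym s a) = of_bool (contents x (int (eval x \<rho> a)) = s)"
| "eval x \<rho> Len = length x"

datatype outp = Write bool | Cat outp outp | For expr outp

fun written :: "bool list \<Rightarrow> (nat \<Rightarrow> nat) \<Rightarrow> outp \<Rightarrow> bool list" where
  "written x \<rho> (Write b) = [b]"
| "written x \<rho> (Cat c d) = written x \<rho> c @ written x \<rho> d"
| "written x \<rho> (For a c) = concat (map (\<lambda>i. written x (case_nat i \<rho>) c) [0..<eval x \<rho> a])"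

text \<open>
  The compiled code adds the value to register \<open>u\<close>. Variable \<open>i\<close> is kept in register \<open>r i\<close>,
  and the registers from \<open>t\<close> on are free; they are zero before and after.
\<close>

fun compile_expr :: "expr \<Rightarrow> (nat \<Rightarrow> nat) \<Rightarrow> nat \<Rightarrow> nat \<Rightarrow> prog" where
  "compile_expr (Var i) r u t =
     While (r i) (Prim (Dec (r i)) ;; Prim (Inc u) ;; Prim (Inc t)) ;;
     While t (Prim (Dec t) ;; Prim (Inc (r i)))"
| "compile_expr One r u t = Prim (Inc u)"
| "compile_expr (Add a b) r u t = compile_expr a r u t ;; compile_expr b r u t"
| "compile_expr (Sub a b) r u t =
     compile_expr a r t (t + 2) ;; compile_expr b r (t + 1) (t + 2) ;;
     While (t + 1) (Prim (Dec (t + 1)) ;; Prim (Dec t)) ;;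
     While t (Prim (Dec t) ;; Prim (Inc u))"
| "compile_expr (Sum a b) r u t =
     compile_expr a r t (t + 2) ;;
     While t (Prim (Dec t) ;; compile_expr b (case_nat (t + 1) r) u (t + 2) ;; Prim (Inc (t + 1)))
         ;;
     While (t + 1) (Prim (Dec (t + 1)))"
| "compile_expr (Sym s a) r u t =
     compile_expr a r t (t + 2) ;;
     While t (Prim (Dec t) ;; Prim (Inc (t + 1)) ;; Prim Go_Right) ;;
     Prim (Inc_If s u) ;;
     While (t + 1) (Prim (Dec (t + 1)) ;; Prim Go_Left)"
| "compile_expr Len r u t =
     Prim (Inc_If 1 t) ;; Prim (Inc_If 2 t) ;;
     While t (Prim (Dec t) ;; Prim (Inc u) ;; Prim (Inc (t + 1)) ;; Prim Go_Right ;;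
       Prim (Inc_If 1 t) ;; Prim (Inc_If 2 t)) ;;
     While (t + 1) (Prim (Dec (t + 1)) ;; Prim Go_Left)"

fun compile_outp :: "outp \<Rightarrow> (nat \<Rightarrow> nat) \<Rightarrow> nat \<Rightarrow> prog" where
  "compile_outp (Write b) r t = Prim (Emit b)"
| "compile_outp (Cat c d) r t = compile_outp c r t ;; compile_outp d r t"
| "compile_outp (For a c) r t =
     compile_expr a r t (t + 2) ;;
     While t (Prim (Dec t) ;; compile_outp c (case_nat (t + 1) r) (t + 2) ;; Prim (Inc (t + 1))) ;;
     While (t + 1) (Prim (Dec (t + 1)))"

section \<open>Running times of compiled programs\<close>

definition runs :: "bool list \<Rightarrow> prog \<Rightarrow> store \<Rightarrow> nat \<Rightarrow> store \<Rightarrow> bool" where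
  "runs x c s b s' \<longleftrightarrow> (\<exists>t\<le>b. exec x c s t s')"

lemma runs_mono: "runs x c s b s' \<Longrightarrow> b \<le> b' \<Longrightarrow> runs x c s b' s'"
  unfolding runs_def by (meson order_trans)

lemma runs_Prim: "prim_sem x p s = s' \<Longrightarrow> runs x (Prim p) s 1 s'"
  unfolding runs_def using exec_Prim by blast

lemma runs_Seq: "runs x c s a s' \<Longrightarrow> runs x d s' b s'' \<Longrightarrow> runs x (c ;; d) s (a + b) s''"
  unfolding runs_def by (elim exE conjE) (rule exI, rule conjI, rule add_mono, assumption,
      assumption, rule exec_Seq)

text \<open>The family \<open>s\<close> lists the stores met at the successive tests, so it serves
  as loop invariant and as round counter at once; each round adds \<open>2\<close> for test and
  jump.\<close>

lemma runs_While:
  assumes "\<And>j. j < n \<Longrightarrow> fst (s j) r \<noteq> 0" "fst (s n) r = 0"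
    and "\<And>j. j < n \<Longrightarrow> runs x c (s j) b (s (Suc j))" "s 0 = s0" "s n = s1"
  shows "runs x (While r c) s0 (n * (b + 2) + 1) s1"
  using assms
proof (induction n arbitrary: s s0)
  case 0
  then show ?case unfolding runs_def using exec_While_False[of s0 r x c] by auto
next
  case (Suc n)
  have "runs x (While r c) (s 1) (n * (b + 2) + 1) s1"
    by (rule Suc.IH[of "\<lambda>j. s (Suc j)"]) (use Suc.prems in auto)
  then obtain t where t: "t \<le> n * (b + 2) + 1" "exec x (While r c) (s 1) t s1"
    unfolding runs_def by blast
  obtain t' where t': "t' \<le> b" "exec x c (s 0) t' (s 1)"
    using Suc.prems(3)[of 0] unfolding runs_def One_nat_def by blast
  have "exec x (While r c) (s 0) (t' + t + 2) s1"
    by (rule exec_While_True[OF _ t'(2) t(2)]) (use Suc.prems(1) in auto)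
  moreover have "t' + t + 2 \<le> Suc n * (b + 2) + 1" using t t' by simp
  ultimately show ?case unfolding runs_def Suc.prems(4)[symmetric] by (intro exI conjI)
qed

lemma poly_nat_mono: "m \<le> n \<Longrightarrow> poly p m \<le> poly p n" for p :: "nat poly"
  by (induction p) (simp_all add: mult_le_mono)

lemma runs_Dec:
  assumes "e r = n" "e' = e(r := 0)"
  shows "runs x (While r (Prim (Dec r))) (e, h, y) (3 * n + 1) (e', h, y)"
proof -
  have "runs x (While r (Prim (Dec r))) (e, h, y) (n * (1 + 2) + 1) (e', h, y)"
    by (rule runs_While[where s = "\<lambda>j. (e(r := n - j), h, y)"]; (intro runs_Seq[OF runs_Prim[OF
        refl]] runs_Prim)?;
         use assms in \<open>auto simp: fun_eq_iff\<close>)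
  then show ?thesis by (rule runs_mono) simp
qed

lemma runs_move:
  assumes "e r = n" "r \<noteq> u" "e' = e(r := 0, u := e u + n)"
  shows "runs x (While r (Prim (Dec r) ;; Prim (Inc u))) (e, h, y) (4 * n + 1) (e', h, y)"
proof -
  have "runs x (While r (Prim (Dec r) ;; Prim (Inc u))) (e, h, y) (n * ((1 + 1) + 2) + 1) (e', h,
      y)"
    by (rule runs_While[where s = "\<lambda>j. (e(r := n - j, u := e u + j), h, y)"]; (intro runs_Seq[OF
        runs_Prim[OF refl]] runs_Prim)?;
         use assms in \<open>auto simp: fun_eq_iff\<close>)
  then show ?thesis by (rule runs_mono) simp
qed

lemma runs_rewind:
  assumes "e r = n" "e' = e(r := 0)" "h = int n"
  shows "runs x (While r (Prim (Dec r) ;; Prim Go_Left)) (e, h, y) (4 * n + 1) (e', 0, y)"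
proof -
  have "runs x (While r (Prim (Dec r) ;; Prim Go_Left)) (e, h, y) (n * ((1 + 1) + 2) + 1) (e', 0,
      y)"
    by (rule runs_While[where s = "\<lambda>j. (e(r := n - j), int (n - j), y)"]; (intro runs_Seq[OF
        runs_Prim[OF refl]] runs_Prim)?;
         use assms in \<open>auto simp: fun_eq_iff\<close>)
  then show ?thesis by (rule runs_mono) simp
qed

text \<open>Register \<open>t\<close> counts the remaining rounds and \<open>t + 1\<close> the
  finished ones, which makes the latter the loop variable. Of the \<open>7\<close> extra steps per
  round, four belong to the two updates, the test and the jump, and three to clearing
  \<open>t + 1\<close> at the end.\<close>

lemma runs_for:
  assumes body: "\<And>j. j < n \<Longrightarrow>
      runs x c ((E j)(t := n - Suc j, Suc t := j), 0, Y j) b ((E (Suc j))(t := n - Suc j, Suc t :=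
          j), 0, Y (Suc j))"
    and "E 0 = e" "Y 0 = y" "\<And>j. E j t = 0" "\<And>j. E j (Suc t) = 0"
  shows "runs x (While t (Prim (Dec t) ;; c ;; Prim (Inc (t + 1))) ;; While (t + 1) (Prim (Dec (t +
      1))))
     (e(t := n), 0, y) (n * (b + 7) + 2) (E n, 0, Y n)"
proof -
  have "runs x (While t (Prim (Dec t) ;; c ;; Prim (Inc (t + 1))))
     (e(t := n), 0, y) (n * ((1 + (b + 1)) + 2) + 1) ((E n)(t := 0, Suc t := n), 0, Y n)"
  proof (rule runs_While[where s = "\<lambda>j. ((E j)(t := n - j, Suc t := j), 0, Y j)"])
    fix j assume j: "j < n"
    show "runs x (Prim (Dec t) ;; c ;; Prim (Inc (t + 1))) ((E j)(t := n - j, Suc t := j), 0, Y j)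
       (1 + (b + 1)) ((E (Suc j))(t := n - Suc j, Suc t := Suc j), 0, Y (Suc j))"
      by (intro runs_Seq[OF runs_Prim runs_Seq[OF body[OF j] runs_Prim]])
         (use j in \<open>auto simp: fun_eq_iff\<close>)
  qed (use assms(2,3) assms(4,5)[of 0] in \<open>auto simp: fun_eq_iff\<close>)
  from runs_Seq[OF this runs_Dec[where r = "t + 1" and n = n and e' = "E n"]]
  show ?thesis by (rule runs_mono) (use assms in \<open>auto simp: fun_eq_iff algebra_simps\<close>)
qed

text \<open>The polynomial takes a common bound \<open>m\<close> on the input length and the
  variables, since under a binder the new variable may exceed the input length. The value is bounded
  along with the time because it may become the number of rounds of an enclosing loop.\<close>

definition compiles_within :: "expr \<Rightarrow> nat poly \<Rightarrow> bool" where
  "compiles_within a p \<longleftrightarrow> (\<forall>x m e y r u t. length x \<le> m \<longrightarrow>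
     (\<forall>i. r i < t \<and> r i \<noteq> u \<and> e (r i) \<le> m) \<longrightarrow> u < t \<longrightarrow> (\<forall>k\<ge>t. e k = 0) \<longrightarrow>
     eval x (e \<circ> r) a \<le> poly p m \<and>
     runs x (compile_expr a r u t) (e, 0, y) (poly p m) (e(u := e u + eval x (e \<circ> r) a), 0, y))"

lemma compiles_withinI:
  assumes "\<And>x m e y r u t. length x \<le> m \<Longrightarrow> \<forall>i. r i < t \<and> r i \<noteq> u \<and> e (r i) \<le> m \<Longrightarrow> u < t \<Longrightarrow>
    \<forall>k\<ge>t. e k = 0 \<Longrightarrow> eval x (e \<circ> r) a \<le> poly p m \<and>
     runs x (compile_expr a r u t) (e, 0, y) (poly p m) (e(u := e u + eval x (e \<circ> r) a), 0, y)"
  shows "compiles_within a p"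
  unfolding compiles_within_def by (intro allI impI) (rule assms)

lemma compiles_withinD:
  assumes "compiles_within a p" "length x \<le> m" "\<forall>i. r i < t \<and> r i \<noteq> u \<and> e (r i) \<le> m" "u < t"
    "\<forall>k\<ge>t. e k = 0"
  shows "eval x (e \<circ> r) a \<le> poly p m \<and>
     runs x (compile_expr a r u t) (e, 0, y) (poly p m) (e(u := e u + eval x (e \<circ> r) a), 0, y)"
  using assms(1)[unfolded compiles_within_def, rule_format, OF assms(2) _ assms(4)] assms(3,5)
      by blast

lemma compile_expr_correct: "\<exists>p. compiles_within a p"
proof (induction a)
  case (Var i)
  show ?case
  \<comment> \<open>Reading a counter empties it. Its value \<open>n\<close> is therefore moved to
    \<open>u\<close> and \<open>t\<close> at once, in \<open>5 * n + 1\<close> steps, and moved back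
    from \<open>t\<close> in \<open>4 * n + 1\<close> steps.\<close>
  proof (intro exI[of _ "[:2, 9:]"] compiles_withinI)
    fix x :: "bool list" and m e and y :: "bool list" and r :: "nat \<Rightarrow> nat" and u t :: nat
    assume *: "length x \<le> m" "\<forall>i. r i < t \<and> r i \<noteq> u \<and> e (r i) \<le> m" "u < t" "\<forall>k\<ge>t. e k = 0"
    let ?n = "e (r i)"
    have r: "r i < t" "r i \<noteq> u" "r i \<noteq> t" "u \<noteq> t" "?n \<le> m" using *(2,3) by (auto simp: less_le)
    have 1: "runs x (While (r i) (Prim (Dec (r i)) ;; Prim (Inc u) ;; Prim (Inc t)))
       (e, 0, y) (?n * ((1 + (1 + 1)) + 2) + 1) (e(r i := 0, u := e u + ?n, t := ?n), 0, y)"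
      by (rule runs_While[where s = "\<lambda>j. (e(r i := ?n - j, u := e u + j, t := j), 0, y)"]; (intro
          runs_Seq[OF runs_Prim[OF refl]] runs_Prim)?;
         use r *(4) in \<open>auto simp: fun_eq_iff\<close>)
    have 2: "runs x (While t (Prim (Dec t) ;; Prim (Inc (r i)))) (e(r i := 0, u := e u + ?n, t :=
        ?n), 0, y)
       (4 * ?n + 1) (e(u := e u + ?n), 0, y)"
      by (rule runs_move) (use r *(4) in \<open>auto simp: fun_eq_iff\<close>)
    from runs_mono[OF runs_Seq[OF 1 2], of "poly [:2, 9:] m"]
    show "eval x (e \<circ> r) (Var i) \<le> poly [:2, 9:] m \<and>
      runs x (compile_expr (Var i) r u t) (e, 0, y) (poly [:2, 9:] m) (e(u := e u + eval x (e \<circ> r)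
          (Var i)), 0, y)"
      using r by (simp add: algebra_simps)
  qed
next
  case One
  show ?case
    by (intro exI[of _ "[:1:]"] compiles_withinI conjI) (auto intro!: runs_mono[OF runs_Prim] simp:
        fun_eq_iff)
next
  case (Add a b)
  obtain p where "compiles_within a p" using Add.IH(1) by blast
  note p = compiles_withinD[OF this]
  obtain p' where "compiles_within b p'" using Add.IH(2) by blast
  note p' = compiles_withinD[OF this]
  show ?case
  proof (intro exI[of _ "p + p'"] compiles_withinI)
    fix x :: "bool list" and m e and y :: "bool list" and r :: "nat \<Rightarrow> nat" and u t :: nat
    assume *: "length x \<le> m" "\<forall>i. r i < t \<and> r i \<noteq> u \<and> e (r i) \<le> m" "u < t" "\<forall>k\<ge>t. e k = 0"
    let ?e = "e(u := e u + eval x (e \<circ> r) a)"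
    have r: "?e \<circ> r = e \<circ> r" using *(2) by (auto simp: fun_eq_iff)
    have **: "\<forall>i. r i < t \<and> r i \<noteq> u \<and> ?e (r i) \<le> m" "\<forall>k\<ge>t. ?e k = 0" using * by auto
    from p[OF *, of y] p'[of x m r t u ?e y, OF *(1) **(1) *(3) **(2)] r
    show "eval x (e \<circ> r) (Add a b) \<le> poly (p + p') m \<and>
      runs x (compile_expr (Add a b) r u t) (e, 0, y) (poly (p + p') m) (e(u := e u + eval x (e \<circ> r)
          (Add a b)), 0, y)"
      by (auto intro!: runs_Seq simp: add.assoc intro: add_mono)
  qed
next
  case (Sub a b)
  obtain p where "compiles_within a p" using Sub.IH(1) by blast
  note p = compiles_withinD[OF this]
  obtain p' where "compiles_within b p'" using Sub.IH(2) by blast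
  note p' = compiles_withinD[OF this]
  let ?p = "5 * p + 5 * p' + 2"
  show ?case
  proof (intro exI[of _ ?p] compiles_withinI)
    fix x :: "bool list" and m e and y :: "bool list" and r :: "nat \<Rightarrow> nat" and u t :: nat
    assume *: "length x \<le> m" "\<forall>i. r i < t \<and> r i \<noteq> u \<and> e (r i) \<le> m" "u < t" "\<forall>k\<ge>t. e k = 0"
    let ?a = "eval x (e \<circ> r) a" and ?b = "eval x (e \<circ> r) b"
    let ?e = "e(t := ?a)"
    have ne: "r i \<noteq> t" "r i \<noteq> Suc t" for i using *(2)[rule_format, of i] by auto
    have r: "?e \<circ> r = e \<circ> r" using ne by (auto simp: fun_eq_iff)
    have pa: "?a \<le> poly p m \<and> runs x (compile_expr a r t (t + 2)) (e, 0, y) (poly p m) (?e, 0, y)"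
      using p[of x m r "t + 2" t e y] * ne by (auto simp: less_Suc_eq)
    have pb: "?b \<le> poly p' m \<and> runs x (compile_expr b r (t + 1) (t + 2)) (?e, 0, y) (poly p' m) (e(t
        := ?a, t + 1 := ?b), 0, y)"
      using p'[of x m r "t + 2" "t + 1" ?e y] * ne r by (auto simp: less_Suc_eq)
    have 1: "runs x (While (t + 1) (Prim (Dec (t + 1)) ;; Prim (Dec t))) (e(t := ?a, t + 1 := ?b),
        0, y)
       (?b * ((1 + 1) + 2) + 1) (e(t := ?a - ?b), 0, y)"
      by (rule runs_While[where s = "\<lambda>j. (e(t := ?a - j, t + 1 := ?b - j), 0, y)"]; (intro
          runs_Seq[OF runs_Prim[OF refl]] runs_Prim)?;
         use *(4) in \<open>auto simp: fun_eq_iff\<close>)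
    have 2: "runs x (While t (Prim (Dec t) ;; Prim (Inc u))) (e(t := ?a - ?b), 0, y)
       (4 * (?a - ?b) + 1) (e(u := e u + (?a - ?b)), 0, y)"
      by (rule runs_move) (use *(3,4) in \<open>auto simp: fun_eq_iff\<close>)
    have "poly p m + (poly p' m + (?b * ((1 + 1) + 2) + 1 + (4 * (?a - ?b) + 1))) \<le> poly ?p m"
      using pa pb by simp linarith
    from runs_mono[OF runs_Seq[OF conjunct2[OF pa] runs_Seq[OF conjunct2[OF pb] runs_Seq[OF 1 2]]]
        this] pa
    show "eval x (e \<circ> r) (Sub a b) \<le> poly ?p m \<and>
      runs x (compile_expr (Sub a b) r u t) (e, 0, y) (poly ?p m) (e(u := e u + eval x (e \<circ> r) (Sub
          a b)), 0, y)"
      by auto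
  qed
next
  case (Sum a b)
  obtain p where "compiles_within a p" using Sum.IH(1) by blast
  note p = compiles_withinD[OF this]
  obtain p' where "compiles_within b p'" using Sum.IH(2) by blast
  note p' = compiles_withinD[OF this]
  \<comment> \<open>Inside the body the bound variable can be as large as the value of
    \<open>a\<close>, so the bound for \<open>b\<close> is evaluated at
    \<open>m + poly p m\<close>.\<close>
  define p'' where "p'' = pcompose p' ([:0, 1:] + p)"
  have p'': "poly p'' m = poly p' (m + poly p m)" for m by (simp add: p''_def poly_pcompose)
  let ?p = "p + p * (p'' + 7) + 2"
  show ?case
  proof (intro exI[of _ ?p] compiles_withinI)
    fix x :: "bool list" and m e and y :: "bool list" and r :: "nat \<Rightarrow> nat" and u t :: nat
    assume *: "length x \<le> m" "\<forall>i. r i < t \<and> r i \<noteq> u \<and> e (r i) \<le> m" "u < t" "\<forall>k\<ge>t. e k = 0"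
    let ?a = "eval x (e \<circ> r) a" and ?b = "\<lambda>j. eval x (case_nat j (e \<circ> r)) b"
    let ?e = "e(t := ?a)"
    have ne: "r i \<noteq> t" "r i \<noteq> Suc t" for i using *(2)[rule_format, of i] by auto
    have pa: "?a \<le> poly p m" and ra: "runs x (compile_expr a r t (t + 2)) (e, 0, y) (poly p m) (?e,
        0, y)"
      using p[of x m r "t + 2" t e y] * ne by (auto simp: less_Suc_eq)
    have pb: "?b j \<le> poly p'' m \<and>
      runs x (compile_expr b (case_nat (t + 1) r) u (t + 2))
        ((e(u := e u + (\<Sum>i<j. ?b i)))(t := ?a - Suc j, Suc t := j), 0, y) (poly p'' m)
        ((e(u := e u + (\<Sum>i<Suc j. ?b i)))(t := ?a - Suc j, Suc t := j), 0, y)" if "j < ?a" for j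
    proof -
      let ?e = "(e(u := e u + (\<Sum>i<j. ?b i)))(t := ?a - Suc j, Suc t := j)"
      have c: "?e \<circ> case_nat (t + 1) r = case_nat j (e \<circ> r)"
        using *(2) ne by (auto simp: fun_eq_iff split: nat.splits)
      have bnd: "\<forall>i. case_nat (t + 1) r i < t + 2 \<and> case_nat (t + 1) r i \<noteq> u
          \<and> ?e (case_nat (t + 1) r i) \<le> m + poly p m"
      proof
        fix i
        show "case_nat (t + 1) r i < t + 2 \<and> case_nat (t + 1) r i \<noteq> u
            \<and> ?e (case_nat (t + 1) r i) \<le> m + poly p m"
        proof (cases i)
          case (Suc k)
          have "r k < t" "r k \<noteq> u" "e (r k) \<le> m" using *(2) by auto
          then show ?thesis using Suc by auto
        qed (use * pa that in auto)
      qed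
      have q: "length x \<le> m + poly p m" "u < t + 2" "\<forall>k\<ge>t + 2. ?e k = 0" using * by auto
      have e': "?e(u := ?e u + ?b j) = (e(u := e u + (\<Sum>i<Suc j. ?b i)))(t := ?a - Suc j, Suc t :=
          j)"
        using *(3) by (auto simp: fun_eq_iff)
      from p'[of x "m + poly p m" "case_nat (t + 1) r" "t + 2" u ?e y, OF q(1) bnd q(2,3), unfolded
          c e']
      show ?thesis unfolding p'' .
    qed
    have 1: "runs x (While t (Prim (Dec t) ;; compile_expr b (case_nat (t + 1) r) u (t + 2) ;; Prim
        (Inc (t + 1))) ;;
        While (t + 1) (Prim (Dec (t + 1))))
       (?e, 0, y) (?a * (poly p'' m + 7) + 2) (e(u := e u + (\<Sum>i<?a. ?b i)), 0, y)"
      by (rule runs_for[where Y = "\<lambda>_. y" and E = "\<lambda>j. e(u := e u + (\<Sum>i<j. ?b i))"])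
         (use pb * in auto)
    have "poly p m + (?a * (poly p'' m + 7) + 2) \<le> poly ?p m"
      using mult_right_mono[OF pa, of "poly p'' m + 7"] by (simp add: algebra_simps)
    from runs_mono[OF runs_Seq[OF ra 1] this]
    have run: "runs x (compile_expr (Sum a b) r u t) (e, 0, y) (poly ?p m) (e(u := e u + eval x (e \<circ>
        r) (Sum a b)), 0, y)"
      by simp
    have "(\<Sum>i<?a. ?b i) \<le> ?a * poly p'' m" using sum_bounded_above[of "{..<?a}" ?b
        "poly p'' m"] pb by auto
    also have "\<dots> \<le> poly p m * poly p'' m" by (rule mult_right_mono[OF pa]) simp
    also have "\<dots> \<le> poly ?p m" by (simp add: algebra_simps)
    finally show "eval x (e \<circ> r) (Sum a b) \<le> poly ?p m \<and>
      runs x (compile_expr (Sum a b) r u t) (e, 0, y) (poly ?p m) (e(u := e u + eval x (e \<circ> r) (Sum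
          a b)), 0, y)"
      using run by simp
  qed
next
  case (Sym s a)
  obtain p where "compiles_within a p" using Sym.IH by blast
  note p = compiles_withinD[OF this]
  let ?p = "10 * p + 3"
  show ?case
  proof (intro exI[of _ ?p] compiles_withinI)
    fix x :: "bool list" and m e and y :: "bool list" and r :: "nat \<Rightarrow> nat" and u t :: nat
    assume *: "length x \<le> m" "\<forall>i. r i < t \<and> r i \<noteq> u \<and> e (r i) \<le> m" "u < t" "\<forall>k\<ge>t. e k = 0"
    let ?a = "eval x (e \<circ> r) a"
    let ?v = "eval x (e \<circ> r) (Sym s a)"
    let ?e = "e(t := ?a)"
    have ne: "r i \<noteq> t" "r i \<noteq> Suc t" for i using *(2)[rule_format, of i] by auto
    have pa: "?a \<le> poly p m" and ra: "runs x (compile_expr a r t (t + 2)) (e, 0, y) (poly p m) (?e,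
        0, y)"
      using p[of x m r "t + 2" t e y] * ne by (auto simp: less_Suc_eq)
    have 1: "runs x (While t (Prim (Dec t) ;; Prim (Inc (t + 1)) ;; Prim Go_Right)) (?e, 0, y)
       (?a * ((1 + (1 + 1)) + 2) + 1) (e(t + 1 := ?a), int ?a, y)"
      by (rule runs_While[where s = "\<lambda>j. (e(t := ?a - j, t + 1 := j), int j, y)"]; (intro
          runs_Seq[OF runs_Prim[OF refl]] runs_Prim)?;
         use *(4) in \<open>auto simp: fun_eq_iff\<close>)
    have 2: "runs x (Prim (Inc_If s u)) (e(t + 1 := ?a), int ?a, y) 1 (e(t + 1 := ?a, u := e u +
        ?v), int ?a, y)"
      by (rule runs_Prim) (use *(3) in \<open>auto simp: fun_eq_iff\<close>)
    have 3: "runs x (While (t + 1) (Prim (Dec (t + 1)) ;; Prim Go_Left)) (e(t + 1 := ?a, u := e u +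
        ?v), int ?a, y)
       (4 * ?a + 1) (e(u := e u + ?v), 0, y)"
      by (rule runs_rewind) (use *(3,4) in \<open>auto simp: fun_eq_iff\<close>)
    have "poly p m + ((?a * ((1 + (1 + 1)) + 2) + 1) + (1 + (4 * ?a + 1))) \<le> poly ?p m"
      using pa by (simp add: algebra_simps)
    from runs_mono[OF runs_Seq[OF ra runs_Seq[OF 1 runs_Seq[OF 2 3]]] this]
    show "?v \<le> poly ?p m \<and>
      runs x (compile_expr (Sym s a) r u t) (e, 0, y) (poly ?p m) (e(u := e u + ?v), 0, y)"
      by simp
  qed
next
  case Len
  let ?p = "[:4, 12:] :: nat poly"
  show ?case
  proof (intro exI[of _ ?p] compiles_withinI)
    fix x :: "bool list" and m e and y :: "bool list" and r :: "nat \<Rightarrow> nat" and u t :: nat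
    assume *: "length x \<le> m" "\<forall>i. r i < t \<and> r i \<noteq> u \<and> e (r i) \<le> m" "u < t" "\<forall>k\<ge>t. e k = 0"
    let ?n = "length x"
    \<comment> \<open>A loop can only test a counter, so \<open>t\<close> holds the flag that the
      head still scans an input symbol; \<open>t + 1\<close> remembers the way back.\<close>
    let ?s = "\<lambda>j. (e(t := of_bool (j < ?n), u := e u + j, t + 1 := j), int j, y)"
    have 0: "runs x (Prim (Inc_If 1 t)) (e, 0, y) 1 (e(t := of_bool (contents x 0 = 1)), 0, y)"
      "runs x (Prim (Inc_If 2 t)) (e(t := of_bool (contents x 0 = 1)), 0, y) 1 (?s 0)"
      by (rule runs_Prim; use * in \<open>force simp: fun_eq_iff contents_def\<close>)+
    have 1: "runs x (While t (Prim (Dec t) ;; Prim (Inc u) ;; Prim (Inc (t + 1)) ;; Prim Go_Right ;;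
       Prim (Inc_If 1 t) ;; Prim (Inc_If 2 t))) (?s 0)
       (?n * ((1 + (1 + (1 + (1 + (1 + 1))))) + 2) + 1) (?s ?n)"
    proof (rule runs_While[where s = ?s])
      fix j assume "j < ?n"
      then show "runs x (Prim (Dec t) ;; Prim (Inc u) ;; Prim (Inc (t + 1)) ;; Prim Go_Right ;;
         Prim (Inc_If 1 t) ;; Prim (Inc_If 2 t)) (?s j) (1 + (1 + (1 + (1 + (1 + 1))))) (?s (Suc
             j))"
        by (intro runs_Seq[OF runs_Prim[OF refl]] runs_Prim)
           (use *(3) in \<open>auto simp: fun_eq_iff contents_def\<close>)
    qed (use *(3) in auto)
    have 3: "runs x (While (t + 1) (Prim (Dec (t + 1)) ;; Prim Go_Left)) (?s ?n)
       (4 * ?n + 1) (e(u := e u + ?n), 0, y)"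
      by (rule runs_rewind) (use *(3,4) in \<open>auto simp: fun_eq_iff\<close>)
    from runs_mono[OF runs_Seq[OF 0(1) runs_Seq[OF 0(2) runs_Seq[OF 1 3]]], of "poly ?p m"] *(1)
    show "eval x (e \<circ> r) Len \<le> poly ?p m \<and>
      runs x (compile_expr Len r u t) (e, 0, y) (poly ?p m) (e(u := e u + eval x (e \<circ> r) Len), 0,
          y)"
      by simp
  qed
qed

definition prints_within :: "outp \<Rightarrow> nat poly \<Rightarrow> bool" where
  "prints_within c p \<longleftrightarrow> (\<forall>x m e y r t. length x \<le> m \<longrightarrow> (\<forall>i. r i < t \<and> e (r i) \<le> m) \<longrightarrow>
     (\<forall>k\<ge>t. e k = 0) \<longrightarrow>
     runs x (compile_outp c r t) (e, 0, y) (poly p m) (e, 0, y @ written x (e \<circ> r) c))"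

lemma prints_withinI:
  assumes "\<And>x m e y r t. length x \<le> m \<Longrightarrow> \<forall>i. r i < t \<and> e (r i) \<le> m \<Longrightarrow> \<forall>k\<ge>t. e k = 0 \<Longrightarrow>
     runs x (compile_outp c r t) (e, 0, y) (poly p m) (e, 0, y @ written x (e \<circ> r) c)"
  shows "prints_within c p"
  unfolding prints_within_def by (intro allI impI) (rule assms)

lemma prints_withinD:
  assumes "prints_within c p" "length x \<le> m" "\<forall>i. r i < t \<and> e (r i) \<le> m" "\<forall>k\<ge>t. e k = 0"
  shows "runs x (compile_outp c r t) (e, 0, y) (poly p m) (e, 0, y @ written x (e \<circ> r) c)"
  using assms(1)[unfolded prints_within_def, rule_format, OF assms(2)] assms(3,4) by blast

lemma compile_outp_correct: "\<exists>p. prints_within c p"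
proof (induction c)
  case (Write b)
  show ?case
    by (intro exI[of _ "[:1:]"] prints_withinI) (auto intro!: runs_mono[OF runs_Prim])
next
  case (Cat c d)
  obtain p where "prints_within c p" using Cat.IH(1) by blast
  note p = prints_withinD[OF this]
  obtain p' where "prints_within d p'" using Cat.IH(2) by blast
  note p' = prints_withinD[OF this]
  show ?case
  proof (intro exI[of _ "p + p'"] prints_withinI)
    fix x :: "bool list" and m e and y :: "bool list" and r :: "nat \<Rightarrow> nat" and t :: nat
    assume *: "length x \<le> m" "\<forall>i. r i < t \<and> e (r i) \<le> m" "\<forall>k\<ge>t. e k = 0"
    from runs_Seq[OF p[OF *] p'[OF *]]
    show "runs x (compile_outp (Cat c d) r t) (e, 0, y) (poly (p + p') m) (e, 0, y @ written x (e \<circ>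
        r) (Cat c d))"
      by simp
  qed
next
  case (For a c)
  obtain p where "compiles_within a p" using compile_expr_correct[of a] by blast
  note p = compiles_withinD[OF this]
  obtain p' where "prints_within c p'" using For.IH by blast
  note p' = prints_withinD[OF this]
  define p'' where "p'' = pcompose p' ([:0, 1:] + p)"
  have p'': "poly p'' m = poly p' (m + poly p m)" for m by (simp add: p''_def poly_pcompose)
  let ?p = "p + p * (p'' + 7) + 2"
  show ?case
  proof (intro exI[of _ ?p] prints_withinI)
    fix x :: "bool list" and m e and y :: "bool list" and r :: "nat \<Rightarrow> nat" and t :: nat
    assume *: "length x \<le> m" "\<forall>i. r i < t \<and> e (r i) \<le> m" "\<forall>k\<ge>t. e k = 0"
    let ?a = "eval x (e \<circ> r) a" and ?c = "\<lambda>j. written x (case_nat j (e \<circ> r)) c"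
    let ?y = "\<lambda>j. y @ concat (map ?c [0..<j])"
    have ne: "r i \<noteq> t" "r i \<noteq> Suc t" for i using *(2)[rule_format, of i] by auto
    have pa: "?a \<le> poly p m" and ra: "runs x (compile_expr a r t (t + 2)) (e, 0, y) (poly p m) (e(t
        := ?a), 0, y)"
      using p[of x m r "t + 2" t e y] * ne by (auto simp: less_Suc_eq)
    have pb: "runs x (compile_outp c (case_nat (t + 1) r) (t + 2))
        (e(t := ?a - Suc j, Suc t := j), 0, ?y j) (poly p'' m) (e(t := ?a - Suc j, Suc t := j), 0,
            ?y (Suc j))"
      if "j < ?a" for j
    proof -
      let ?e = "e(t := ?a - Suc j, Suc t := j)"
      have "?e \<circ> case_nat (t + 1) r = case_nat j (e \<circ> r)"
        using *(2) ne by (auto simp: fun_eq_iff split: nat.splits)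
      moreover have "\<forall>i. case_nat (t + 1) r i < t + 2 \<and> ?e (case_nat (t + 1) r i) \<le> m + poly p m"
      proof
        fix i
        show "case_nat (t + 1) r i < t + 2 \<and> ?e (case_nat (t + 1) r i) \<le> m + poly p m"
        proof (cases i)
          case (Suc k)
          have "r k < t" "e (r k) \<le> m" using *(2) by auto
          then show ?thesis using Suc by auto
        qed (use * pa that in auto)
      qed
      ultimately show ?thesis
        using p'[of x "m + poly p m" "case_nat (t + 1) r" "t + 2" ?e "?y j"] *
        by (simp add: p'')
    qed
    have 1: "runs x (While t (Prim (Dec t) ;; compile_outp c (case_nat (t + 1) r) (t + 2) ;; Prim
        (Inc (t + 1))) ;;
        While (t + 1) (Prim (Dec (t + 1))))
       (e(t := ?a), 0, y) (?a * (poly p'' m + 7) + 2) (e, 0, ?y ?a)"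
      by (rule runs_for[where Y = ?y and E = "\<lambda>j. e"]) (use pb * in auto)
    have "poly p m + (?a * (poly p'' m + 7) + 2) \<le> poly ?p m"
      using mult_right_mono[OF pa, of "poly p'' m + 7"] by (simp add: algebra_simps)
    from runs_mono[OF runs_Seq[OF ra 1] this]
    show "runs x (compile_outp (For a c) r t) (e, 0, y) (poly ?p m) (e, 0, y @ written x (e \<circ> r)
        (For a c))"
      by simp
  qed
qed

theorem polytime_written: "polytime (\<lambda>x. written x (\<lambda>_. 0) c)"
proof -
  obtain p where "prints_within c p" using compile_outp_correct[of c] by blast
  note p = prints_withinD[OF this]
  show ?thesis
  proof (rule polytime_if_exec[where p = p])
    fix x
    \<comment> \<open>All variables of the closed program share register \<open>0\<close>, which
      holds zero; the free registers begin at \<open>1\<close>.\<close>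
    have "runs x (compile_outp c (\<lambda>_. 0) 1) (\<lambda>_. 0, 0, []) (poly p (length x)) (\<lambda>_. 0, 0, written x
        (\<lambda>_. 0) c)"
      using p[of x "length x" "\<lambda>_. 0" 1 "\<lambda>_. 0" "[]"] by (simp add: comp_def)
    then obtain t where "t \<le> poly p (length x)"
      "exec x (compile_outp c (\<lambda>_. 0) 1) (\<lambda>_. 0, 0, []) t (\<lambda>_. 0, 0, written x (\<lambda>_. 0) c)"
      unfolding runs_def by auto
    then show "\<exists>t e h. t \<le> poly p (length x) \<and>
       exec x (compile_outp c (\<lambda>_. 0) 1) (\<lambda>_. 0, 0, []) t (e, h, written x (\<lambda>_. 0) c)"
      by (intro exI conjI)
  qed
qed

section \<open>Closure properties of definable functions\<close>

text \<open>Definability is stated for functions of the input and an environment, so that closure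
  rules can descend under binders. Resolution with these rules then finds the expressions, and none
  has to be written out.\<close>

definition num :: "(bool list \<Rightarrow> (nat \<Rightarrow> nat) \<Rightarrow> nat) \<Rightarrow> bool" where
  "num f \<longleftrightarrow> (\<exists>a. \<forall>x \<rho>. f x \<rho> = eval x \<rho> a)"

definition prd :: "(bool list \<Rightarrow> (nat \<Rightarrow> nat) \<Rightarrow> bool) \<Rightarrow> bool" where
  "prd P \<longleftrightarrow> num (\<lambda>x \<rho>. of_bool (P x \<rho>))"

definition str :: "(bool list \<Rightarrow> (nat \<Rightarrow> nat) \<Rightarrow> bool list) \<Rightarrow> bool" where
  "str F \<longleftrightarrow> (\<exists>c. \<forall>x \<rho>. F x \<rho> = written x \<rho> c)"

named_theorems closure

section \<open>Renaming and substitution of variables\<close>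

fun rename :: "(nat \<Rightarrow> nat) \<Rightarrow> expr \<Rightarrow> expr" where
  "rename r (Var i) = Var (r i)"
| "rename r One = One"
| "rename r (Add a b) = Add (rename r a) (rename r b)"
| "rename r (Sub a b) = Sub (rename r a) (rename r b)"
| "rename r (Sum a b) = Sum (rename r a) (rename (case_nat 0 (Suc \<circ> r)) b)"
| "rename r (Sym s a) = Sym s (rename r a)"
| "rename r Len = Len"

fun subst :: "(nat \<Rightarrow> expr) \<Rightarrow> expr \<Rightarrow> expr" where
  "subst \<sigma> (Var i) = \<sigma> i"
| "subst \<sigma> One = One"
| "subst \<sigma> (Add a b) = Add (subst \<sigma> a) (subst \<sigma> b)"
| "subst \<sigma> (Sub a b) = Sub (subst \<sigma> a) (subst \<sigma> b)"
| "subst \<sigma> (Sum a b) = Sum (subst \<sigma> a) (subst (case_nat (Var 0) (rename Suc \<circ> \<sigma>)) b)"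
| "subst \<sigma> (Sym s a) = Sym s (subst \<sigma> a)"
| "subst \<sigma> Len = Len"

fun rename_outp :: "(nat \<Rightarrow> nat) \<Rightarrow> outp \<Rightarrow> outp" where
  "rename_outp r (Write b) = Write b"
| "rename_outp r (Cat c d) = Cat (rename_outp r c) (rename_outp r d)"
| "rename_outp r (For a c) = For (rename r a) (rename_outp (case_nat 0 (Suc \<circ> r)) c)"

lemma case_nat_comp: "case_nat i \<rho> \<circ> case_nat 0 (Suc \<circ> r) = case_nat i (\<rho> \<circ> r)"
  by (auto simp: fun_eq_iff split: nat.splits)

lemma eval_rename: "eval x \<rho> (rename r a) = eval x (\<rho> \<circ> r) a"
  by (induction a arbitrary: \<rho> r) (simp_all add: case_nat_comp)

lemma eval_subst: "eval x \<rho> (subst \<sigma> a) = eval x (\<lambda>i. eval x \<rho> (\<sigma> i)) a"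
proof (induction a arbitrary: \<rho> \<sigma>)
  case (Sum a b)
  have "(\<lambda>k. eval x (case_nat i \<rho>) (case_nat (Var 0) (rename Suc \<circ> \<sigma>) k)) = case_nat i (\<lambda>k. eval x \<rho>
      (\<sigma> k))" for i
    by (auto simp: fun_eq_iff eval_rename comp_def split: nat.splits)
  then show ?case using Sum by simp
qed simp_all

lemma written_rename: "written x \<rho> (rename_outp r c) = written x (\<rho> \<circ> r) c"
  by (induction c arbitrary: \<rho> r) (simp_all add: case_nat_comp eval_rename)

text \<open>An expression can be picked for every variable, so all variables are replaced by one
  simultaneous substitution.\<close>

lemma num_comp:
  assumes "num f" "\<And>i. num (g i)"
  shows "num (\<lambda>x \<rho>. f x (\<lambda>i. g i x \<rho>))"
proof -
  obtain a where a: "\<And>x \<rho>. f x \<rho> = eval x \<rho> a" using assms(1) unfolding num_def by blast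
  obtain \<sigma> where "\<And>i x \<rho>. g i x \<rho> = eval x \<rho> (\<sigma> i)" using assms(2) unfolding num_def by metis
  then show ?thesis unfolding num_def a by (intro exI[of _ "subst \<sigma> a"]) (simp add: eval_subst)
qed

lemma num_eval: "num (\<lambda>x \<rho>. eval x \<rho> a)"
  unfolding num_def by blast

lemma num_var [closure]: "num (\<lambda>x \<rho>. \<rho> i)"
  unfolding num_def by (rule exI[of _ "Var i"]) simp

lemma num_length [closure]: "num (\<lambda>x \<rho>. length x)"
  unfolding num_def by (rule exI[of _ Len]) simp

lemma num_add [closure]: "num f \<Longrightarrow> num g \<Longrightarrow> num (\<lambda>x \<rho>. f x \<rho> + g x \<rho>)"
  unfolding num_def by (metis eval.simps(3))

lemma num_diff [closure]: "num f \<Longrightarrow> num g \<Longrightarrow> num (\<lambda>x \<rho>. f x \<rho> - g x \<rho>)"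
  unfolding num_def by (metis eval.simps(4))

lemma num_const [closure]: "num (\<lambda>x \<rho>. c)"
proof (induction c)
  case 0
  show ?case unfolding num_def by (rule exI[of _ "Sub One One"]) simp
next
  case (Suc c)
  then obtain a where "\<And>x \<rho>. c = eval x \<rho> a" unfolding num_def by blast
  then show ?case unfolding num_def by (intro exI[of _ "Add a One"]) simp
qed

lemma num_Suc [closure]: "num f \<Longrightarrow> num (\<lambda>x \<rho>. Suc (f x \<rho>))"
  using num_add[OF _ num_const[of 1]] by simp

text \<open>The second premise is the body in de Bruijn form: the index becomes variable
  \<open>0\<close> and the other variables move up by one. Stated this way, resolution does the
  renumbering.\<close>

lemma num_sum [closure]:
  assumes "num e" "num (\<lambda>x \<rho>. F x (\<lambda>i. \<rho> (Suc i)) (\<rho> 0))"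
  shows "num (\<lambda>x \<rho>. \<Sum>i<e x \<rho>. F x \<rho> i)"
proof -
  obtain a where a: "\<And>x \<rho>. e x \<rho> = eval x \<rho> a" using assms(1) unfolding num_def by blast
  obtain b where b: "\<And>x \<rho>. F x (\<lambda>i. \<rho> (Suc i)) (\<rho> 0) = eval x \<rho> b" using assms(2)
      unfolding num_def by blast
  have "F x \<rho> i = eval x (case_nat i \<rho>) b" for x \<rho> i using b[of x "case_nat i \<rho>"] by simp
  then show ?thesis unfolding num_def a by (intro exI[of _ "Sum a b"]) simp
qed

text \<open>A product is a sum with a constant summand.\<close>

lemma num_mult [closure]:
  assumes "num f" "num g"
  shows "num (\<lambda>x \<rho>. f x \<rho> * g x \<rho>)"
proof -
  have "num (\<lambda>x \<rho>. g x (\<lambda>i. \<rho> (Suc i)))" using assms(2) by (rule num_comp) (rule num_var)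
  from num_sum[OF assms(1), of "\<lambda>x \<rho> i. g x \<rho>", OF this] show ?thesis by simp
qed

lemma num_of_bool [closure]: "prd P \<Longrightarrow> num (\<lambda>x \<rho>. of_bool (P x \<rho>))"
  by (simp add: prd_def)

lemma prd_not [closure]: "prd P \<Longrightarrow> prd (\<lambda>x \<rho>. \<not> P x \<rho>)"
proof -
  have "of_bool (\<not> p) = 1 - (of_bool p :: nat)" for p by simp
  then show "prd P \<Longrightarrow> ?thesis" unfolding prd_def using num_diff[OF num_const[of 1]] by simp
qed

lemma prd_conj [closure]: "prd P \<Longrightarrow> prd Q \<Longrightarrow> prd (\<lambda>x \<rho>. P x \<rho> \<and> Q x \<rho>)"
  unfolding prd_def of_bool_conj by (rule num_mult)

lemma prd_disj [closure]: "prd P \<Longrightarrow> prd Q \<Longrightarrow> prd (\<lambda>x \<rho>. P x \<rho> \<or> Q x \<rho>)"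
  using prd_not[OF prd_conj[OF prd_not prd_not]] by simp

lemma prd_imp [closure]: "prd P \<Longrightarrow> prd Q \<Longrightarrow> prd (\<lambda>x \<rho>. P x \<rho> \<longrightarrow> Q x \<rho>)"
  unfolding imp_conv_disj by (intro closure)

lemma prd_le [closure]:
  assumes "num f" "num g"
  shows "prd (\<lambda>x \<rho>. f x \<rho> \<le> g x \<rho>)"
proof -
  have "(\<lambda>x \<rho>. of_bool (f x \<rho> \<le> g x \<rho>)) = (\<lambda>x \<rho>. 1 - (f x \<rho> - g x \<rho>))" by (auto simp: fun_eq_iff)
  then show ?thesis unfolding prd_def using assms by (auto intro: closure)
qed

lemma prd_less [closure]: "num f \<Longrightarrow> num g \<Longrightarrow> prd (\<lambda>x \<rho>. f x \<rho> < g x \<rho>)"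
  unfolding less_eq_Suc_le by (intro closure)

lemma prd_eq [closure]: "num f \<Longrightarrow> num g \<Longrightarrow> prd (\<lambda>x \<rho>. f x \<rho> = g x \<rho>)"
  unfolding eq_iff[of "_ :: nat"] by (intro closure)

lemma prd_ex [closure]:
  assumes "num e" "prd (\<lambda>x \<rho>. P x (\<lambda>i. \<rho> (Suc i)) (\<rho> 0))"
  shows "prd (\<lambda>x \<rho>. \<exists>i<e x \<rho>. P x \<rho> i)"
proof -
  have "prd (\<lambda>x \<rho>. 0 < (\<Sum>i<e x \<rho>. of_bool (P x \<rho> i) :: nat))" using assms by (intro closure)
  moreover have "0 < (\<Sum>i<n. of_bool (Q i) :: nat) \<longleftrightarrow> (\<exists>i<n. Q i)" for n :: nat and Q
    by (induction n) (auto simp: less_Suc_eq)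
  ultimately show ?thesis by simp
qed

lemma prd_all [closure]:
  assumes "num e" "prd (\<lambda>x \<rho>. P x (\<lambda>i. \<rho> (Suc i)) (\<rho> 0))"
  shows "prd (\<lambda>x \<rho>. \<forall>i<e x \<rho>. P x \<rho> i)"
  using prd_not[OF prd_ex[OF assms(1) prd_not[OF assms(2)]]] by simp

lemma num_if [closure]:
  assumes "prd P" "num f" "num g"
  shows "num (\<lambda>x \<rho>. if P x \<rho> then f x \<rho> else g x \<rho>)"
proof -
  have "(\<lambda>x \<rho>. if P x \<rho> then f x \<rho> else g x \<rho>) =
      (\<lambda>x \<rho>. of_bool (P x \<rho>) * f x \<rho> + of_bool (\<not> P x \<rho>) * g x \<rho>)" by (auto simp: fun_eq_iff)
  then show ?thesis using assms by (auto intro!: closure)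
qed

lemma num_contents [closure]:
  assumes "num f"
  shows "num (\<lambda>x \<rho>. contents x (int (f x \<rho>)))"
proof -
  have *: "prd (\<lambda>x \<rho>. contents x (int (f x \<rho>)) = s)" for s
    using assms unfolding prd_def num_def by (metis eval.simps(6))
  have "(\<lambda>x \<rho>. contents x (int (f x \<rho>))) =
      (\<lambda>x \<rho>. of_bool (contents x (int (f x \<rho>)) = 1) + 2 * of_bool (contents x (int (f x \<rho>)) = 2))"
    by (auto simp: fun_eq_iff contents_def)
  then show ?thesis using * by (auto intro!: num_add num_mult num_const num_of_bool)
qed

lemma num_poly [closure]: "num f \<Longrightarrow> num (\<lambda>x \<rho>. poly p (f x \<rho>))"
  by (induction p) (auto intro: closure)

lemma num1: "num (\<lambda>x \<rho>. F x (\<rho> 0)) \<Longrightarrow> num a \<Longrightarrow> num (\<lambda>x \<rho>. F x (a x \<rho>))"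
  using num_comp[of "\<lambda>x \<rho>. F x (\<rho> 0)" "\<lambda>_. a"] by simp

lemma num2: "num (\<lambda>x \<rho>. F x (\<rho> 0) (\<rho> 1)) \<Longrightarrow> num a \<Longrightarrow> num b \<Longrightarrow> num (\<lambda>x \<rho>. F x (a x \<rho>) (b x \<rho>))"
  using num_comp[of "\<lambda>x \<rho>. F x (\<rho> 0) (\<rho> 1)" "\<lambda>i. if i = 0 then a else b"] by auto

lemma num3: "num (\<lambda>x \<rho>. F x (\<rho> 0) (\<rho> 1) (\<rho> 2)) \<Longrightarrow> num a \<Longrightarrow> num b \<Longrightarrow> num c \<Longrightarrow>
    num (\<lambda>x \<rho>. F x (a x \<rho>) (b x \<rho>) (c x \<rho>))"
  using num_comp[of "\<lambda>x \<rho>. F x (\<rho> 0) (\<rho> 1) (\<rho> 2)" "\<lambda>i. if i = 0 then a else if i = 1 then b else c"]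
  by auto

text \<open>The triangular number in the pairing function is a sum over an initial segment, which
  avoids division.\<close>

lemma num_prod_encode [closure]: "num f \<Longrightarrow> num g \<Longrightarrow> num (\<lambda>x \<rho>. prod_encode (f x \<rho>, g x \<rho>))"
proof (rule num2[of "\<lambda>_ a b. prod_encode (a, b)"])
  have "triangle n = (\<Sum>i<Suc n. i)" for n by (induction n) auto
  then have "prod_encode (a, b) = (\<Sum>i<Suc (a + b). i) + a" for a b by (simp add: prod_encode_def)
  then show "num (\<lambda>x \<rho>. prod_encode (\<rho> 0, \<rho> 1))" by (simp only:) (intro closure)
qed

text \<open>Both components of a pair are at most its code, so decoding is an exhaustive search in
  which exactly one pair contributes.\<close>

lemma prod_decode_sum:
  "h (prod_decode z) = (\<Sum>i<Suc z. \<Sum>j<Suc z. of_bool (prod_encode (i, j) = z) * h (i, j))"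
  for h :: "nat \<times> nat \<Rightarrow> nat"
proof -
  obtain a b where z: "z = prod_encode (a, b)" by (metis prod_decode_inverse surj_pair)
  have le: "a \<le> z" "b \<le> z" unfolding z by (rule le_prod_encode_1 le_prod_encode_2)+
  have "(\<Sum>j<Suc z. of_bool (prod_encode (i, j) = z) * h (i, j)) = (\<Sum>j<Suc z. if j = b then of_bool
      (i = a) * h (i, j) else 0)" for i
    by (rule sum.cong) (auto simp: z)
  also have "\<dots> i = (if i = a then h (a, b) else 0)" for i using le by (simp add: sum.delta)
  finally show ?thesis using le by (simp add: z)
qed

lemma num_fst_decode [closure]: "num f \<Longrightarrow> num (\<lambda>x \<rho>. fst (prod_decode (f x \<rho>)))"
proof (rule num1[of "\<lambda>_ a. fst (prod_decode a)"])
  show "num (\<lambda>x \<rho>. fst (prod_decode (\<rho> 0)))"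
    unfolding prod_decode_sum[of fst] fst_conv by (intro closure)
qed

lemma num_snd_decode [closure]: "num f \<Longrightarrow> num (\<lambda>x \<rho>. snd (prod_decode (f x \<rho>)))"
proof (rule num1[of "\<lambda>_ a. snd (prod_decode a)"])
  show "num (\<lambda>x \<rho>. snd (prod_decode (\<rho> 0)))"
    unfolding prod_decode_sum[of snd] snd_conv by (intro closure)
qed

lemma num_list_encode_Nil [closure]: "num (\<lambda>x \<rho>. list_encode [])"
  by (rule num_const)

lemma num_list_encode_Cons [closure]:
  "num f \<Longrightarrow> num (\<lambda>x \<rho>. list_encode (l x \<rho>)) \<Longrightarrow> num (\<lambda>x \<rho>. list_encode (f x \<rho> # l x \<rho>))"
  by (simp add: closure)

text \<open>Any function is definable when cut off at a constant, by a chain of case distinctions.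
  This is how the transition table of an unknown machine enters an expression.\<close>

lemma num_table [closure]:
  assumes "num f"
  shows "num (\<lambda>x \<rho>. if f x \<rho> < b then h (f x \<rho>) else 0)"
proof (induction b)
  case 0
  show ?case by (simp add: num_const)
next
  case (Suc b)
  have "(\<lambda>x \<rho>. if f x \<rho> < Suc b then h (f x \<rho>) else 0) =
      (\<lambda>x \<rho>. if f x \<rho> = b then h b else if f x \<rho> < b then h (f x \<rho>) else 0)"
          by (auto simp: fun_eq_iff)
  then show ?case using Suc assms by (auto intro!: num_if prd_eq num_const)
qed

section \<open>Definable strings and random access to them\<close>

lemma str_written: "str (\<lambda>x \<rho>. written x \<rho> c)"
  unfolding str_def by blast

lemma str_single [closure]: "str (\<lambda>x \<rho>. [b])"
  unfolding str_def by (rule exI[of _ "Write b"]) simp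

lemma str_append [closure]: "str F \<Longrightarrow> str G \<Longrightarrow> str (\<lambda>x \<rho>. F x \<rho> @ G x \<rho>)"
  unfolding str_def by (metis written.simps(2))

lemma str_Cons [closure]: "str F \<Longrightarrow> str (\<lambda>x \<rho>. b # F x \<rho>)"
  using str_append[OF str_single] by simp

lemma str_for [closure]:
  assumes "num e" "str (\<lambda>x \<rho>. F x (\<lambda>i. \<rho> (Suc i)) (\<rho> 0))"
  shows "str (\<lambda>x \<rho>. concat (map (F x \<rho>) [0..<e x \<rho>]))"
proof -
  obtain a where a: "\<And>x \<rho>. e x \<rho> = eval x \<rho> a" using assms(1) unfolding num_def by blast
  obtain b where b: "\<And>x \<rho>. F x (\<lambda>i. \<rho> (Suc i)) (\<rho> 0) = written x \<rho> b" using assms(2)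
      unfolding str_def by blast
  have "F x \<rho> = (\<lambda>i. written x (case_nat i \<rho>) b)" for x \<rho>
  proof
    show "F x \<rho> i = written x (case_nat i \<rho>) b" for i using b[of x "case_nat i \<rho>"] by simp
  qed
  then show ?thesis unfolding str_def a by (intro exI[of _ "For a b"]) simp
qed

text \<open>A condition is a loop with zero rounds or one.\<close>

lemma str_when: 
  assumes "prd P" "str F"
  shows "str (\<lambda>x \<rho>. if P x \<rho> then F x \<rho> else [])"
proof -
  obtain c where c: "\<And>x \<rho>. F x \<rho> = written x \<rho> c" using assms(2) unfolding str_def by blast
  have "str (\<lambda>x \<rho>. F x (\<lambda>i. \<rho> (Suc i)))"
    unfolding str_def by (rule exI[of _ "rename_outp Suc c"]) (simp add: c written_rename comp_def)
  from str_for[OF num_of_bool[OF assms(1)], of "\<lambda>x \<rho> i. F x \<rho>", OF this]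
  have "str (\<lambda>x \<rho>. concat (map (\<lambda>i. F x \<rho>) [0..<of_bool (P x \<rho>)]))" .
  moreover have "concat (map (\<lambda>i. l) [0..<of_bool p]) = (if p then l else [])" for l ::
      "bool list" and p
    by simp
  ultimately show ?thesis by (simp only:)
qed

lemma str_if [closure]:
  assumes "prd P" "str F" "str G"
  shows "str (\<lambda>x \<rho>. if P x \<rho> then F x \<rho> else G x \<rho>)"
proof -
  have "(\<lambda>x \<rho>. if P x \<rho> then F x \<rho> else G x \<rho>) =
      (\<lambda>x \<rho>. (if P x \<rho> then F x \<rho> else []) @ (if \<not> P x \<rho> then G x \<rho> else []))"
          by (auto simp: fun_eq_iff)
  then show ?thesis using assms by (auto intro!: str_append str_when prd_not)
qed

lemma str_Nil [closure]: "str (\<lambda>x \<rho>. [])"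
  using str_when[of "\<lambda>_ _. False", OF _ str_single] by (simp add: prd_def num_const)

lemma str_encode_nat [closure]:
  assumes "num f"
  shows "str (\<lambda>x \<rho>. encode_nat (f x \<rho>))"
proof -
  have "encode_nat n = concat (map (\<lambda>_. [True]) [0..<n]) @ [False]" for n
    by (simp add: encode_nat_def map_replicate_const)
  then show ?thesis using assms by (simp only:) (intro closure)
qed

lemma num_length_str:
  assumes "str F"
  shows "num (\<lambda>x \<rho>. length (F x \<rho>))"
proof -
  obtain c where c: "\<And>x \<rho>. F x \<rho> = written x \<rho> c" using assms unfolding str_def by blast
  have "num (\<lambda>x \<rho>. length (written x \<rho> c))"
  proof (induction c)
    case (For a c)
    have "num (\<lambda>x \<rho>. \<Sum>i<eval x \<rho> a. length (written x (case_nat i \<rho>) c))"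
    proof (rule num_sum)
      show "num (\<lambda>x \<rho>. eval x \<rho> a)" by (rule num_eval)
      have "case_nat (\<rho> 0) (\<lambda>i. \<rho> (Suc i)) = \<rho>" for \<rho> :: "nat \<Rightarrow> nat"
        by (auto simp: fun_eq_iff split: nat.splits)
      then show "num (\<lambda>x \<rho>. length (written x (case_nat (\<rho> 0) (\<lambda>i. \<rho> (Suc i))) c))" using For
          by simp
    qed
    then show ?case by (simp add: length_concat comp_def sum_list_sum_nth atLeast0LessThan)
  qed (auto intro: closure)
  then show ?thesis by (simp add: c)
qed

lemma contents_append_nat:
  "contents (xs @ ys) (int i) =
     (if i < length xs then contents xs (int i) else contents ys (int (i - length xs)))"
  by (cases "i < length xs") (auto simp: contents_def nth_append nat_diff_distrib)

lemma contents_eq_0: "length xs \<le> i \<Longrightarrow> contents xs (int i) = 0"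
  by (simp add: contents_def)

text \<open>Prefix sums of lengths give the start of each block. A block that ends before position
  \<open>i\<close> contributes the blank, which is \<open>0\<close>, so at most the block containing
  \<open>i\<close> survives in the sum.\<close>

lemma contents_concat:
  "contents (concat (map G [0..<n])) (int i) =
     (\<Sum>j<n. if (\<Sum>l<j. length (G l)) \<le> i then contents (G j) (int (i - (\<Sum>l<j. length (G l)))) else
         0)"
proof (induction n)
  case 0
  then show ?case by (simp add: contents_def)
next
  case (Suc n)
  have len: "length (concat (map G [0..<n])) = (\<Sum>l<n. length (G l))"
    by (simp add: length_concat comp_def sum_list_sum_nth atLeast0LessThan)
  show ?case
  proof (cases "i < (\<Sum>l<n. length (G l))")
    case False
    then have "contents (concat (map G [0..<n])) (int i) = 0"
        by (intro contents_eq_0) (simp add: len)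
    then show ?thesis using False Suc by (simp add: contents_append_nat len)
  qed (use Suc in \<open>simp add: contents_append_nat len\<close>)
qed

text \<open>A single symbol of an output is computed without producing the output. This lets a
  predicate compare a printed string with the input.\<close>

lemma num_contents_str:
  assumes "str F" "num f"
  shows "num (\<lambda>x \<rho>. contents (F x \<rho>) (int (f x \<rho>)))"
proof -
  obtain c where c: "\<And>x \<rho>. F x \<rho> = written x \<rho> c" using assms unfolding str_def by blast
  have len: "num (\<lambda>x \<rho>. length (written x (\<lambda>i. \<rho> (g i)) c))" for c g
    using num_comp[OF num_length_str[OF str_written] num_var] .
  \<comment> \<open>The position is made variable \<open>0\<close>, in front of the variables of
    \<open>c\<close>, so that the induction hypothesis can be used at the shifted positions inside
    later blocks.\<close>
  have "num (\<lambda>x \<rho>. contents (written x (\<lambda>i. \<rho> (Suc i)) c) (int (\<rho> 0)))"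
  proof (induction c)
    case (Write b)
    have "contents [b] (int i) = (if i = 0 then if b then 2 else 1 else 0)" for i
      by (auto simp: contents_def)
    then show ?case by (cases b) (auto intro!: closure)
  next
    case (Cat c d)
    have "num (\<lambda>x \<rho>. contents (written x (\<lambda>i. \<rho> (Suc i)) d) (int (\<rho> 0 - length (written x (\<lambda>i. \<rho>
        (Suc i)) c))))"
    proof -
      let ?g = "\<lambda>i x \<rho>. case i of 0 \<Rightarrow> \<rho> 0 - length (written x (\<lambda>i. \<rho> (Suc i)) c) | Suc k \<Rightarrow> \<rho> (Suc
          k)"
      have "num (?g i)" for i
        by (cases i) (auto intro!: closure len)
      from num_comp[OF Cat(2), of ?g, OF this] show ?thesis by simp
    qed
    with Cat(1) show ?case
      unfolding written.simps contents_append_nat by (intro closure len)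
  next
    case (For a c)
    have cn: "case_nat (\<rho> 0) (\<lambda>i. \<rho> (g i)) = (\<lambda>i. \<rho> (case i of 0 \<Rightarrow> 0 | Suc k \<Rightarrow> g k))" for \<rho> ::
        "nat \<Rightarrow> nat" and g
      by (auto simp: fun_eq_iff split: nat.splits)
    have a: "num (\<lambda>x \<rho>. eval x (\<lambda>i. \<rho> (g i)) a)" for g
      by (rule num_comp[OF num_eval num_var])
    define s where "s = (\<lambda>x \<rho> j. \<Sum>l<j. length (written x (case_nat l \<rho>) c))"
    have s: "num (\<lambda>x \<rho>. s x (\<lambda>i. \<rho> (g i)) (\<rho> k))" for g k
      unfolding s_def by (rule num_sum[OF num_var]) (unfold cn[of _ "\<lambda>i. Suc (g i)"], rule len)
    have d: "num (\<lambda>x \<rho>. contents (written x (case_nat (\<rho> 0) (\<lambda>i. \<rho> (Suc (Suc i)))) c) (int (\<rho> (Suc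
        0) - s x (\<lambda>i. \<rho> (Suc (Suc i))) (\<rho> 0))))"
    proof -
      let ?g = "\<lambda>i x \<rho>. case i of 0 \<Rightarrow> \<rho> (Suc 0) - s x (\<lambda>i. \<rho> (Suc (Suc i))) (\<rho> 0)
          | Suc k \<Rightarrow> case_nat (\<rho> 0) (\<lambda>i. \<rho> (Suc (Suc i))) k"
      have "num (?g i)" for i
        unfolding cn[of _ "\<lambda>i. Suc (Suc i)"] by (cases i) (auto intro!: closure s)
      from num_comp[OF For, of ?g, OF this] show ?thesis by simp
    qed
    show ?case
      unfolding written.simps contents_concat
      by (rule num_sum[OF a] num_if prd_le s[unfolded s_def] num_var num_const d[unfolded s_def])+
  qed
  moreover let ?g = "\<lambda>i x \<rho>. case i of 0 \<Rightarrow> f x \<rho> | Suc k \<Rightarrow> \<rho> k"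
  have "num (?g i)" for i
    using assms(2) by (cases i) (auto intro: num_var)
  ultimately show ?thesis using num_comp[of _ ?g] by (force simp: c)
qed

lemma polytime_str: "str F \<Longrightarrow> polytime (\<lambda>x. F x (\<lambda>_. 0))"
  unfolding str_def using polytime_written by auto

lemma class_P_if_prd:
  assumes "prd P"
  shows "{x. P x (\<lambda>_. 0)} \<in> class_P"
proof -
  have "str (\<lambda>x \<rho>. [P x \<rho>])"
    using str_if[OF assms str_single[of True] str_single[of False]]
    by (rule back_subst[of str]) (auto simp: fun_eq_iff)
  from polytime_str[OF this] show ?thesis by (simp add: class_P_def)
qed

section \<open>Membership in NP\<close>

text \<open>A least number says something only if it is attained. An injection of the finite vertex
  set into the naturals is a proper coloring, so the minimum exists; with at most one color both
  ends of an edge would agree.\<close>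

lemma chromatic_number_le_1_iff:
  assumes "finite S" "\<forall>e\<in>E. card e = 2 \<and> e \<subseteq> S"
  shows "chromatic_number S E \<le> 1 \<longleftrightarrow> E = {}"
proof
  assume "E = {}"
  then have "proper_coloring S E 1 (\<lambda>_. 0)" by (auto simp: proper_coloring_def)
  then show "chromatic_number S E \<le> 1" unfolding chromatic_number_def by (intro Least_le) blast
next
  assume le: "chromatic_number S E \<le> 1"
  obtain f :: "'a \<Rightarrow> nat" where f: "f ` S = {..<card S}" "inj_on f S"
    using ex_bij_betw_finite_nat[OF assms(1)] unfolding bij_betw_def atLeast0LessThan by blast
  have "f u \<noteq> f v" if "{u, v} \<in> E" for u v
  proof -
    have "u \<in> S" "v \<in> S" "u \<noteq> v" using assms(2)[rule_format, OF that] by auto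
    then show ?thesis using f(2) by (auto dest: inj_onD)
  qed
  then have "\<exists>k c. proper_coloring S E k c" using f(1) unfolding proper_coloring_def by blast
  then have "\<exists>c. proper_coloring S E (chromatic_number S E) c"
    unfolding chromatic_number_def by (rule LeastI_ex)
  then obtain c where c: "proper_coloring S E (chromatic_number S E) c" by blast
  show "E = {}"
  proof (rule ccontr)
    assume "E \<noteq> {}"
    then obtain e where e: "e \<in> E" by blast
    then obtain u v where uv: "e = {u, v}" using assms(2) by (metis card_2_iff)
    have "u \<in> S" "v \<in> S" using assms(2) e uv by auto
    then have "c u < 1" "c v < 1" using c le unfolding proper_coloring_def by fastforce+
    moreover have "c u \<noteq> c v" using c e uv unfolding proper_coloring_def by blast
    ultimately show False by simp
  qed
qed

text \<open>This replaces families of sets by the lists that encode them. Since the listing is free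
  of repetitions, part sizes are lengths and different lists have disjoint sets.\<close>

lemma pcp_yes_iff:
  "distinct (concat ps) \<and> pcp_instance {..<n} (edge_set es) (part_set ps) \<and>
   has_max_part_size (part_set ps) q \<and> pcp_solvable {..<n} (edge_set es) (part_set ps) 1 \<longleftrightarrow>
   distinct (concat ps) \<and> set (concat ps) = {..<n} \<and> [] \<notin> set ps \<and>
   (\<forall>(u, v)\<in>set es. u < n \<and> v < n \<and> u \<noteq> v) \<and>
   (\<forall>p\<in>set ps. length p \<le> q) \<and> (\<exists>p\<in>set ps. length p = q) \<and>
   (\<exists>S. S \<subseteq> {..<n} \<and> (\<forall>p\<in>set ps. card (S \<inter> set p) = 1) \<and> (\<forall>(u, v)\<in>set es. u \<notin> S \<or> v \<notin> S))"
  (is "?L \<longleftrightarrow> ?R")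
proof (cases "distinct (concat ps)")
  case True
  have dis: "set p \<inter> set p' = {}" if "p \<in> set ps" "p' \<in> set ps" "p \<noteq> p'" for p p'
    using that True unfolding distinct_concat_iff by blast
  have "disjoint (part_set ps)"
    unfolding disjoint_def part_set_def using dis by blast
  then have part: "partition_on {..<n} (part_set ps) \<longleftrightarrow> set (concat ps) = {..<n} \<and> [] \<notin> set ps"
    unfolding partition_on_def part_set_def by auto
  have graph: "simple_graph {..<n} (edge_set es) \<longleftrightarrow> (\<forall>(u, v)\<in>set es. u < n \<and> v < n \<and> u \<noteq> v)"
    unfolding simple_graph_def edge_set_def by (auto simp: card_insert_if split: prod.splits
        if_splits)
  have "card ` part_set ps = length ` set ps"
    using True unfolding part_set_def distinct_concat_iff image_image
        by (intro image_cong) (auto simp: distinct_card)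
  then have size: "has_max_part_size (part_set ps) q \<longleftrightarrow>
      (\<forall>p\<in>set ps. length p \<le> q) \<and> (\<exists>p\<in>set ps. length p = q)"
    unfolding has_max_part_size_def
    by (cases "ps = []") (auto simp: part_set_def Max_eq_iff[of "length ` set ps"])
  have col: "chromatic_number S (induced_edges (edge_set es) S) \<le> 1 \<longleftrightarrow> (\<forall>(u, v)\<in>set es. u \<notin> S
      \<or> v \<notin> S)"
    if "S \<subseteq> {..<n}" "simple_graph {..<n} (edge_set es)" for S
  proof -
    have "finite S" using that(1) finite_subset by blast
    moreover have "\<forall>e\<in>induced_edges (edge_set es) S. card e = 2 \<and> e \<subseteq> S"
      using that(2) by (auto simp: induced_edges_def simple_graph_def)
    ultimately have "chromatic_number S (induced_edges (edge_set es) S) \<le> 1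
        \<longleftrightarrow> induced_edges (edge_set es) S = {}"
      by (rule chromatic_number_le_1_iff)
    also have "\<dots> \<longleftrightarrow> (\<forall>(u, v)\<in>set es. u \<notin> S \<or> v \<notin> S)"
      by (auto simp: induced_edges_def edge_set_def)
    finally show ?thesis .
  qed
  have "pcp_solvable {..<n} (edge_set es) (part_set ps) 1 \<longleftrightarrow>
     (\<exists>S. S \<subseteq> {..<n} \<and> (\<forall>p\<in>set ps. card (S \<inter> set p) = 1) \<and> (\<forall>(u, v)\<in>set es. u \<notin> S \<or> v \<notin> S))"
    if "simple_graph {..<n} (edge_set es)"
    unfolding pcp_solvable_def selection_def by (rule ex_cong1) (use col[OF _ that] in \<open>auto simp:
        part_set_def\<close>)
  then show ?thesis unfolding pcp_instance_def using part graph size by auto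
qed simp

section \<open>Tables as certificates\<close>

definition table_instance :: "(nat \<Rightarrow> nat \<Rightarrow> nat \<Rightarrow> nat) \<Rightarrow> bool list" where
  "table_instance C = encode_instance (C 0 0 0) 1
     (map (\<lambda>l. (C 3 l 0, C 4 l 0)) [0..<C 1 0 0])
     (map (\<lambda>a. map (C 6 a) [0..<C 5 a 0]) [0..<C 2 0 0])"

text \<open>
  A table lists the number of vertices, edges and parts (rows 0 to 2), the end points of the edges
  (rows 3 and 4), the part sizes (row 5), the elements of the parts (row 6) and, for each part,
  the index of the selected element (row 7).
\<close>

definition table_ok :: "nat \<Rightarrow> (nat \<Rightarrow> nat \<Rightarrow> nat \<Rightarrow> nat) \<Rightarrow> bool" where
  "table_ok q C \<longleftrightarrow>
     (\<forall>l<C 1 0 0. C 3 l 0 < C 0 0 0 \<and> C 4 l 0 < C 0 0 0 \<and> C 3 l 0 \<noteq> C 4 l 0) \<and>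
     (\<forall>a<C 2 0 0. \<forall>b<C 5 a 0. C 6 a b < C 0 0 0) \<and>
     (\<forall>i<C 0 0 0. \<exists>a<C 2 0 0. \<exists>b<C 5 a 0. C 6 a b = i) \<and>
     (\<forall>a<C 2 0 0. \<forall>b<C 5 a 0. \<forall>a'<C 2 0 0. \<forall>b'<C 5 a' 0. C 6 a b = C 6 a' b' \<longrightarrow> a = a' \<and> b = b') \<and>
     (\<forall>a<C 2 0 0. C 7 a 0 < C 5 a 0 \<and> C 5 a 0 \<le> q) \<and> (\<exists>a<C 2 0 0. C 5 a 0 = q) \<and>
     (\<forall>l<C 1 0 0. \<forall>a<C 2 0 0. \<forall>a'<C 2 0 0. \<not> (C 6 a (C 7 a 0) = C 3 l 0
         \<and> C 6 a' (C 7 a' 0) = C 4 l 0))"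

text \<open>Injectivity of row 6 in both indices does double duty: it makes the listing free of
  repetitions, and it prevents the element chosen for one part from lying in another.\<close>

lemma table_instance_in_PCP:
  assumes "table_ok q C"
  shows "table_instance C \<in> PCP_restricted 1 q"
proof -
  define n m k where "n = C 0 0 0" and "m = C 1 0 0" and "k = C 2 0 0"
  define el z ch where "el = C 6" and "z = (\<lambda>a. C 5 a 0)" and "ch = (\<lambda>a. C 7 a 0)"
  define es where "es = map (\<lambda>l. (C 3 l 0, C 4 l 0)) [0..<m]"
  define ps where "ps = map (\<lambda>a. map (el a) [0..<z a]) [0..<k]"
  define S where "S = (\<lambda>a. el a (ch a)) ` {..<k}"
  have edge: "\<And>l. l < m \<Longrightarrow> C 3 l 0 < n \<and> C 4 l 0 < n \<and> C 3 l 0 \<noteq> C 4 l 0"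
    and bnd: "\<And>a b. a < k \<Longrightarrow> b < z a \<Longrightarrow> el a b < n"
    and sur: "\<And>i. i < n \<Longrightarrow> \<exists>a<k. \<exists>b<z a. el a b = i"
    and inj: "\<And>a b a' b'. a < k \<Longrightarrow> b < z a \<Longrightarrow> a' < k \<Longrightarrow> b' < z a' \<Longrightarrow> el a b = el a' b' \<Longrightarrow> a = a'
        \<and> b = b'"
    and ch: "\<And>a. a < k \<Longrightarrow> ch a < z a" and z: "\<And>a. a < k \<Longrightarrow> z a \<le> q" and zq: "\<exists>a<k. z a = q"
    and ind: "\<And>l a a'. l < m \<Longrightarrow> a < k \<Longrightarrow> a' < k \<Longrightarrow> \<not> (el a (ch a) = C 3 l 0 \<and> el a' (ch a') = C 4 l 0)"
    using assms unfolding table_ok_def n_def m_def k_def el_def z_def ch_def by blast+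
  \<comment> \<open>Equal rows are nonempty, because \<open>ch a < z a\<close>, and share their
    first element; injectivity then gives equal indices.\<close>
  have ne: "map (el a) [0..<z a] = map (el a') [0..<z a'] \<Longrightarrow> a < k \<Longrightarrow> a' < k \<Longrightarrow> a = a'" for a a'
  proof -
    assume eq: "map (el a) [0..<z a] = map (el a') [0..<z a']" and a: "a < k" "a' < k"
    have "z a = z a'" using arg_cong[OF eq, of length] by simp
    moreover have "el a 0 = el a' 0" using arg_cong[OF eq, of
        "\<lambda>l. l ! 0"] ch[OF a(1)] ch[OF a(2)] by simp
    ultimately show ?thesis using inj[of a 0 a' 0] a ch[of a] ch[of a'] by auto
  qed
  have "distinct (concat ps)"
  proof (rule distinct_concat)
    have "inj_on (\<lambda>a. map (el a) [0..<z a]) {..<k}" by (rule inj_onI) (rule ne, auto)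
    then show "distinct ps" unfolding ps_def distinct_map by (simp add: atLeast0LessThan)
    show "distinct p" if "p \<in> set ps" for p
    proof -
      from that obtain a where "a < k" "p = map (el a) [0..<z a]" by (auto simp: ps_def)
      then show ?thesis using inj[of a _ a] by (auto simp: distinct_map inj_on_def)
    qed
    show "set p \<inter> set p' = {}" if "p \<in> set ps" "p' \<in> set ps" "p \<noteq> p'" for p p'
    proof -
      from that obtain a a' where a: "a < k" "p = map (el a) [0..<z a]" "a' < k"
          "p' = map (el a') [0..<z a']"
        by (auto simp: ps_def)
      then have "a \<noteq> a'" using that(3) by auto
      then show ?thesis using inj[of a _ a'] a by auto
    qed
  qed
  moreover have "set (concat ps) = {..<n}" 
  proof
    show "set (concat ps) \<subseteq> {..<n}" using bnd by (auto simp: ps_def)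
    show "{..<n} \<subseteq> set (concat ps)"
    proof
      fix i assume "i \<in> {..<n}"
      then obtain a b where "a < k" "b < z a" "el a b = i" using sur[of i] by auto
      then show "i \<in> set (concat ps)" by (auto simp: ps_def intro!: bexI[of _ a])
    qed
  qed
  moreover have "[] \<notin> set ps" 
  proof
    assume "[] \<in> set ps"
    then obtain a where "a < k" "z a = 0" by (auto simp: ps_def)
    then show False using ch[of a] by simp
  qed
  moreover have "\<forall>(u, v)\<in>set es. u < n \<and> v < n \<and> u \<noteq> v" using edge by (auto simp: es_def)
  moreover have "\<forall>p\<in>set ps. length p \<le> q" "\<exists>p\<in>set ps. length p = q" using z zq
      by (auto simp: ps_def)
  moreover have "S \<subseteq> {..<n}" using bnd ch by (auto simp: S_def)
  moreover have "card (S \<inter> set p) = 1" if "p \<in> set ps" for p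
  proof -
    from that obtain a where a: "a < k" "p = map (el a) [0..<z a]" by (auto simp: ps_def)
    have "S \<inter> set p = {el a (ch a)}"
    proof
      show "{el a (ch a)} \<subseteq> S \<inter> set p" using a ch by (auto simp: S_def)
      show "S \<inter> set p \<subseteq> {el a (ch a)}"
      proof
        fix i assume "i \<in> S \<inter> set p"
        then obtain a' b where "a' < k" "b < z a" "i = el a' (ch a')" "i = el a b" using a
            by (auto simp: S_def)
        then show "i \<in> {el a (ch a)}" using inj[of a' "ch a'" a b] ch a by auto
      qed
    qed
    then show ?thesis by simp
  qed
  moreover have "\<forall>(u, v)\<in>set es. u \<notin> S \<or> v \<notin> S"
    using ind by (force simp: es_def S_def)
  ultimately have "distinct (concat ps) \<and> pcp_instance {..<n} (edge_set es) (part_set ps) \<and>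
   has_max_part_size (part_set ps) q \<and> pcp_solvable {..<n} (edge_set es) (part_set ps) 1"
    unfolding pcp_yes_iff by blast
  moreover have "table_instance C = encode_instance n 1 es ps"
    unfolding table_instance_def n_def es_def ps_def m_def k_def el_def z_def ..
  ultimately show ?thesis unfolding PCP_restricted_def by blast
qed

lemma length_encode_nat: "length (encode_nat n) = Suc n"
  by (simp add: encode_nat_def)

lemma length_encode_list: "length (encode_list enc xs) = (\<Sum>x\<leftarrow>xs. Suc (length (enc x))) + 1"
  by (simp add: encode_list_def length_concat comp_def)

lemma length_le_length_encode_list: "length xs \<le> length (encode_list enc xs)"
  unfolding length_encode_list by (induction xs) auto

lemma elem_length_le_length_encode_list: "y \<in> set xs \<Longrightarrow> length (enc y) \<le> length (encode_list enc xs)"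
  unfolding length_encode_list by (induction xs) auto

lemma distinct_concat_nth_eq:
  assumes "distinct (concat ps)" "a < length ps" "b < length (ps ! a)" "a' < length ps"
      "b' < length (ps ! a')"
    and "ps ! a ! b = ps ! a' ! b'"
  shows "a = a' \<and> b = b'"
proof -
  have dis: "set (ps ! i) \<inter> set (ps ! j) = {}" if "distinct (concat ps)" "i < j"
      "j < length ps" for i j ps
    using that
  proof (induction ps arbitrary: i j)
    case (Cons p ps)
    then obtain j' where j: "j = Suc j'" by (cases j) auto
    show ?case
    proof (cases i)
      case 0
      have "ps ! j' \<in> set ps" using Cons.prems j by auto
      then show ?thesis using Cons.prems(1) 0 j by auto
    qed (use Cons j in auto)
  qed simp
  have "a = a'"
  proof (rule ccontr)
    assume "a \<noteq> a'"
    then have "set (ps ! a) \<inter> set (ps ! a') = {}"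
      using dis[OF assms(1), of a a'] dis[OF assms(1), of a' a] assms(2,4) by (cases "a < a'") auto
    moreover have "ps ! a ! b \<in> set (ps ! a)" using assms(2,3) by simp
    moreover have "ps ! a ! b \<in> set (ps ! a')" unfolding assms(6) using assms(4,5) by simp
    ultimately show False by auto
  qed
  moreover have "distinct (ps ! a)" using assms(1,2) by (auto simp: distinct_concat_iff)
  ultimately show ?thesis using assms by (simp add: nth_eq_iff_index_eq)
qed

text \<open>Numbers are encoded in unary and list items have nonempty codes, so all entries and all
  relevant indices are at most \<open>length x\<close>. The value \<open>0\<close> outside this box
  keeps the certificate short.\<close>

lemma PCP_imp_table:
  assumes "x \<in> PCP_restricted 1 q"
  obtains C where "table_instance C = x" "table_ok q C" "\<And>t a b. C t a b \<le> length x"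
    and "\<And>t a b. C t a b \<noteq> 0 \<Longrightarrow> t \<le> 7 \<and> a \<le> length x \<and> b \<le> length x"
proof -
  obtain n es ps where x: "x = encode_instance n 1 es ps"
    and yes: "distinct (concat ps) \<and> pcp_instance {..<n} (edge_set es) (part_set ps) \<and>
      has_max_part_size (part_set ps) q \<and> pcp_solvable {..<n} (edge_set es) (part_set ps) 1"
    using assms unfolding PCP_restricted_def by blast
  from yes obtain S where dist: "distinct (concat ps)" and un: "set (concat ps) = {..<n}" and
      "[] \<notin> set ps"
    and es: "\<forall>(u, v)\<in>set es. u < n \<and> v < n \<and> u \<noteq> v" and le: "\<forall>p\<in>set ps. length p \<le> q"
    and q: "\<exists>p\<in>set ps. length p = q"
    and S: "\<forall>p\<in>set ps. card (S \<inter> set p) = 1" and ind: "\<forall>(u, v)\<in>set es. u \<notin> S \<or> v \<notin> S"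
    unfolding pcp_yes_iff by blast
  have "\<exists>b<length (ps ! a). ps ! a ! b \<in> S" if "a < length ps" for a
  proof -
    have "card (S \<inter> set (ps ! a)) = 1" using S that by auto
    then obtain i where "i \<in> S \<inter> set (ps ! a)" by (auto simp: card_1_singleton_iff)
    then show ?thesis by (auto simp: in_set_conv_nth)
  qed
  then obtain ch where ch: "\<And>a. a < length ps \<Longrightarrow> ch a < length (ps ! a) \<and> ps ! a ! ch a \<in> S" by metis
  define C where "C t a b =
    (if t = 0 \<and> a = 0 \<and> b = 0 then n
     else if t = 1 \<and> a = 0 \<and> b = 0 then length es
     else if t = 2 \<and> a = 0 \<and> b = 0 then length ps
     else if t = 3 \<and> a < length es \<and> b = 0 then fst (es ! a)
     else if t = 4 \<and> a < length es \<and> b = 0 then snd (es ! a)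
     else if t = 5 \<and> a < length ps \<and> b = 0 then length (ps ! a)
     else if t = 6 \<and> a < length ps \<and> b < length (ps ! a) then ps ! a ! b
     else if t = 7 \<and> a < length ps \<and> b = 0 then ch a else 0)" for t a b :: nat
  have es': "fst (es ! l) < n \<and> snd (es ! l) < n \<and> fst (es ! l) \<noteq> snd (es ! l)" if
      "l < length es" for l
    using es nth_mem[OF that] by (cases "es ! l") fastforce
  have ps': "ps ! a ! b < n" if "a < length ps" "b < length (ps ! a)" for a b
  proof -
    have "ps ! a ! b \<in> set (concat ps)" using that by (auto intro!: bexI[of _ "ps ! a"])
    then show ?thesis unfolding un by simp
  qed
  have len: "length x = Suc n + 2 + length (encode_list encode_edge es) + length (encode_list
      (encode_list encode_nat) ps)"
    by (simp add: x encode_instance_def length_encode_nat)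
  have nx: "n \<le> length x" "length es \<le> length x" "length ps \<le> length x"
    using length_le_length_encode_list[of es encode_edge] length_le_length_encode_list[of ps
        "encode_list encode_nat"] len
    by linarith+
  have px: "length (ps ! a) \<le> length x" if "a < length ps" for a
    using elem_length_le_length_encode_list[of "ps ! a" ps "encode_list encode_nat"] len that
      length_le_length_encode_list[of "ps ! a" encode_nat] nth_mem[OF that] by linarith
  show ?thesis
  proof (rule that[of C])
    have "map (\<lambda>l. (fst (es ! l), snd (es ! l))) [0..<length es] = es"
      by (simp add: map_nth)
    then have 1: "map (\<lambda>l. (C 3 l 0, C 4 l 0)) [0..<length es] = es"
      by (auto simp: C_def intro!: nth_equalityI)
    have 2: "map (\<lambda>a. map (C 6 a) [0..<C 5 a 0]) [0..<length ps] = ps"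
      by (auto simp: C_def intro!: nth_equalityI)
    have 3: "C 0 0 0 = n" "C 1 0 0 = length es" "C 2 0 0 = length ps" by (simp_all add: C_def)
    show "table_instance C = x" unfolding table_instance_def x 3 1 2 ..
    show "table_ok q C"
      unfolding table_ok_def
    proof (intro conjI allI impI)
      fix i assume "i < C 0 0 0"
      then have "i \<in> set (concat ps)" unfolding un by (simp add: C_def)
      then obtain p where "p \<in> set ps" "i \<in> set p" by auto
      then obtain a b where "a < length ps" "p = ps ! a" "b < length (ps ! a)" "i = ps ! a ! b"
        by (metis in_set_conv_nth)
      then show "\<exists>a<C 2 0 0. \<exists>b<C 5 a 0. C 6 a b = i"
        by (intro exI[of _ a] conjI exI[of _ b]) (simp_all add: C_def)
    next
      fix l a a' assume la: "l < C 1 0 0" "a < C 2 0 0" "a' < C 2 0 0"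
      then have la': "l < length es" "a < length ps" "a' < length ps" by (simp_all add: C_def)
      have "es ! l \<in> set es" using la' by simp
      then have "fst (es ! l) \<notin> S \<or> snd (es ! l) \<notin> S" using ind by (auto split: prod.splits)
      then show "\<not> (C 6 a (C 7 a 0) = C 3 l 0 \<and> C 6 a' (C 7 a' 0) = C 4 l 0)"
        using ch[OF la'(2)] ch[OF la'(3)] la' by (auto simp: C_def)
    next
      fix a b a' b' assume "a < C 2 0 0" "b < C 5 a 0" "a' < C 2 0 0" "b' < C 5 a' 0"
          "C 6 a b = C 6 a' b'"
      then have "a = a' \<and> b = b'"
        using distinct_concat_nth_eq[OF dist, of a b a' b'] by (simp add: C_def split: if_splits)
      then show "a = a'" "b = b'" by auto
    next
      obtain a where "a < length ps" "length (ps ! a) = q" using q by (auto simp: in_set_conv_nth)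
      then show "\<exists>a<C 2 0 0. C 5 a 0 = q" by (intro exI[of _ a]) (simp add: C_def)
    qed (use es' ps' ch le in \<open>auto simp: C_def\<close>)
    show "C t a b \<le> length x" for t a b
      using nx px[of a] es'[of a] ps'[of a b] ch[of a] by (auto simp: C_def)
    show "C t a b \<noteq> 0 \<Longrightarrow> t \<le> 7 \<and> a \<le> length x \<and> b \<le> length x" for t a b
      using nx px[of a] by (auto simp: C_def split: if_splits)
  qed
qed

section \<open>Positions in an encoded pair\<close>

lemma contents_Cons_Suc: "contents (b # l) (int (Suc i)) = contents l (int i)"
  by (simp add: contents_def del: of_nat_Suc)

lemma contents_Cons_0: "contents (b # l) 0 = (if b then 2 else 1)"
  by (simp add: contents_def)

lemma encode_pair_Nil: "encode_pair [] w = False # w"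
  by (simp add: encode_pair_def)

lemma encode_pair_Cons: "encode_pair (b # x) w = True # b # encode_pair x w"
  by (simp add: encode_pair_def)

lemma length_encode_pair: "length (encode_pair x w) = 2 * length x + 1 + length w"
  by (induction x) (simp_all add: encode_pair_Nil encode_pair_Cons)

lemma contents_encode_pair_marker: "i < length x \<Longrightarrow> contents (encode_pair x w) (int (2 * i)) = 2"
proof (induction x arbitrary: i)
  case (Cons b x)
  then show ?case
    by (cases i) (simp_all add: encode_pair_Cons contents_Cons_0 contents_Cons_Suc mult_Suc_right
        del: of_nat_Suc of_nat_mult)
qed simp

lemma contents_encode_pair_fst:
  "i < length x \<Longrightarrow> contents (encode_pair x w) (int (Suc (2 * i))) = contents x (int i)"
proof (induction x arbitrary: i)
  case (Cons b x)
  then show ?case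
    by (cases i) (simp_all add: encode_pair_Cons contents_Cons_0 contents_Cons_Suc mult_Suc_right
        del: of_nat_Suc of_nat_mult)
qed simp

lemma contents_encode_pair_end: "contents (encode_pair x w) (int (2 * length x)) = 1"
  by (induction x) (simp_all add: encode_pair_Nil encode_pair_Cons contents_Cons_0 contents_Cons_Suc
      mult_Suc_right del: of_nat_Suc of_nat_mult)

lemma contents_encode_pair_snd:
  "contents (encode_pair x w) (int (Suc (2 * length x + j))) = contents w (int j)"
  by (induction x) (simp_all add: encode_pair_Nil encode_pair_Cons contents_Cons_Suc mult_Suc_right
      del: of_nat_Suc of_nat_mult of_nat_add)

lemma contents_inject:
  assumes "length x = length y" "\<And>i. i < length x \<Longrightarrow> contents x (int i) = contents y (int i)"
  shows "x = y"
proof (rule nth_equalityI)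
  show "x ! i = y ! i" if "i < length x" for i
    using assms(2)[OF that] assms(1) that by (auto simp: contents_def split: if_splits)
qed (rule assms(1))

text \<open>The first component ends at the first even position without the marker symbol
  \<open>2\<close>. Counting the \<open>i\<close> for which all markers up to the
  \<open>i\<close>-th are present replaces the scan by a bounded sum.\<close>

definition first_length :: "bool list \<Rightarrow> nat" where
  "first_length y = (\<Sum>i<length y. of_bool (\<forall>j<Suc i. contents y (int (2 * j)) = 2))"

lemma first_length_encode_pair: "first_length (encode_pair x w) = length x"
proof -
  let ?y = "encode_pair x w"
  have "(\<forall>j<Suc i. contents ?y (int (2 * j)) = 2) \<longleftrightarrow> i < length x" for i
    using contents_encode_pair_marker[of _ x w] contents_encode_pair_end[of x w]
    by (metis less_Suc_eq less_trans linorder_not_less not_less_eq num.distinct(1)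
        one_eq_numeral_iff)
  then have "first_length ?y = (\<Sum>i<length ?y. of_bool (i < length x))"
      by (simp add: first_length_def)
  also have "\<dots> = card ({..<length ?y} \<inter> {i. i < length x})" by (simp add: sum.If_cases of_bool_def)
  also have "{..<length ?y} \<inter> {i. i < length x} = {..<length x}" by (auto simp: length_encode_pair)
  finally show ?thesis by simp
qed

text \<open>Entries are in unary: the bit addressed by \<open>t\<close>, \<open>a\<close>,
  \<open>b\<close>, \<open>c\<close> says whether \<open>c\<close> is below the entry. The address
  starts behind the first component and its end mark; digits up to the input length suffice for the
  entries of a true instance.\<close>

definition cert_table :: "bool list \<Rightarrow> nat \<Rightarrow> nat \<Rightarrow> nat \<Rightarrow> nat" where
  "cert_table y t a b = (\<Sum>c<first_length y. of_bool (contents y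
     (int (Suc (2 * first_length y + prod_encode (t, prod_encode (a, prod_encode (b, c)))))) = 2))"

definition pcp_verifier :: "nat \<Rightarrow> bool list set" where
  "pcp_verifier q = {y. length (table_instance (cert_table y)) = first_length y \<and>
     (\<forall>i<first_length y. contents (table_instance (cert_table y)) (int i) = contents y (int (Suc (2
         * i)))) \<and>
     table_ok q (cert_table y)}"

lemma encode_pair_in_pcp_verifier:
  "encode_pair x w \<in> pcp_verifier q \<longleftrightarrow>
     table_instance (cert_table (encode_pair x w)) = x \<and> table_ok q (cert_table (encode_pair x w))"
  unfolding pcp_verifier_def
  by (auto simp: first_length_encode_pair contents_encode_pair_fst intro: contents_inject
      simp del: of_nat_Suc)

lemma num_first_length [closure]: "num (\<lambda>x \<rho>. first_length x)"
  unfolding first_length_def by (intro closure)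

lemma num_cert_table [closure]:
  "num a \<Longrightarrow> num b \<Longrightarrow> num c \<Longrightarrow> num (\<lambda>x \<rho>. cert_table x (a x \<rho>) (b x \<rho>) (c x \<rho>))"
proof (rule num3[of cert_table])
  show "num (\<lambda>x \<rho>. cert_table x (\<rho> 0) (\<rho> 1) (\<rho> 2))"
    unfolding cert_table_def by (intro closure)
qed

lemma encode_list_map_upt:
  "encode_list enc (map f [0..<n]) = concat (map (\<lambda>i. True # enc (f i)) [0..<n]) @ [False]"
  by (simp add: encode_list_def comp_def)

lemma str_table_instance: "str (\<lambda>x \<rho>. table_instance (cert_table x))"
  unfolding table_instance_def encode_instance_def encode_list_map_upt encode_edge_def fst_conv
      snd_conv
  by (intro closure)

lemma pcp_verifier_in_P: "pcp_verifier q \<in> class_P"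
proof -
  have "prd (\<lambda>y \<rho>. length (table_instance (cert_table y)) = first_length y \<and>
     (\<forall>i<first_length y. contents (table_instance (cert_table y)) (int i) = contents y (int (Suc (2
         * i)))) \<and>
     table_ok q (cert_table y))"
    unfolding table_ok_def
    by (intro closure num_length_str num_contents_str str_table_instance)
  from class_P_if_prd[OF this] show ?thesis by (simp add: pcp_verifier_def)
qed

text \<open>The bound on values that accompanies the running time yields the polynomial, so the
  certificate length need not be expanded by hand.\<close>

lemma num_poly_bounded:
  assumes "num f"
  obtains p :: "nat poly" where "\<And>x. f x (\<lambda>_. 0) \<le> poly p (length x)"
proof -
  obtain a where a: "\<And>x \<rho>. f x \<rho> = eval x \<rho> a" using assms unfolding num_def by blast
  obtain p where "compiles_within a p" using compile_expr_correct[of a] by blast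
  note p = compiles_withinD[OF this]
  have "f x (\<lambda>_. 0) \<le> poly p (length x)" for x
    using p[of x "length x" "\<lambda>_. 0" 2 1 "\<lambda>_. 0"] by (simp add: a comp_def)
  then show ?thesis by (rule that)
qed

lemma prod_encode_mono: "a \<le> a' \<Longrightarrow> b \<le> b' \<Longrightarrow> prod_encode (a, b) \<le> prod_encode (a', b')"
  unfolding prod_encode_def triangle_def by (auto intro!: add_mono div_le_mono mult_le_mono)

lemma PCP_in_NP: "PCP_restricted 1 q \<in> class_NP"
proof -
  \<comment> \<open>One more than the largest address of a bit that can be set: the row is at most
    \<open>7\<close>, all other coordinates at most the input length.\<close>
  define l where "l n = Suc (prod_encode (7, prod_encode (n, prod_encode (n, n))))" for n
  have "num (\<lambda>x \<rho>. l (length x))" unfolding l_def by (intro closure)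
  then obtain p :: "nat poly" where p: "\<And>x :: bool list. l (length x) \<le> poly p (length x)"
    by (rule num_poly_bounded) blast
  have "x \<in> PCP_restricted 1 q \<longleftrightarrow> (\<exists>w. length w \<le> poly p (length x)
      \<and> encode_pair x w \<in> pcp_verifier q)" for x
  proof
    assume "x \<in> PCP_restricted 1 q"
    then obtain C where C: "table_instance C = x" "table_ok q C" "\<And>t a b. C t a b \<le> length x"
      "\<And>t a b. C t a b \<noteq> 0 \<Longrightarrow> t \<le> 7 \<and> a \<le> length x \<and> b \<le> length x"
      using PCP_imp_table by blast
    define bit where "bit i = (case prod_decode i of (t, i) \<Rightarrow> case prod_decode i of (a, i) \<Rightarrow>
      case prod_decode i of (b, c) \<Rightarrow> c < C t a b)" for i
    define w where "w = map bit [0..<l (length x)]"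
    have "cert_table (encode_pair x w) t a b = C t a b" for t a b
    proof -
      have "contents w (int (prod_encode (t, prod_encode (a, prod_encode (b, c))))) = 2
          \<longleftrightarrow> c < C t a b"
        if "c < length x" for c
      proof -
        let ?i = "prod_encode (t, prod_encode (a, prod_encode (b, c)))"
        have "?i < l (length x)" if "c < C t a b"
          unfolding l_def less_Suc_eq_le using C(4)[of t a b] that \<open>c < length x\<close>
              by (intro prod_encode_mono) auto
        moreover have "bit ?i \<longleftrightarrow> c < C t a b" by (simp add: bit_def)
        ultimately show ?thesis by (auto simp: contents_def w_def)
      qed
      then have "cert_table (encode_pair x w) t a b = (\<Sum>c<length x. of_bool (c < C t a b))"
        unfolding cert_table_def first_length_encode_pair contents_encode_pair_snd by simp
      also have "\<dots> = card ({..<length x} \<inter> {c. c < C t a b})"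
          by (simp add: sum.If_cases of_bool_def)
      also have "{..<length x} \<inter> {c. c < C t a b} = {..<C t a b}" using C(3)[of t a b] by auto
      finally show ?thesis by simp
    qed
    then have "cert_table (encode_pair x w) = C" by (intro ext)
    then have "encode_pair x w \<in> pcp_verifier q" using C by (simp add: encode_pair_in_pcp_verifier)
    moreover have "length w \<le> poly p (length x)" using p[of x] by (simp add: w_def)
    ultimately show "\<exists>w. length w \<le> poly p (length x) \<and> encode_pair x w \<in> pcp_verifier q" by blast
  next
    assume "\<exists>w. length w \<le> poly p (length x) \<and> encode_pair x w \<in> pcp_verifier q"
    then show "x \<in> PCP_restricted 1 q"
      using table_instance_in_PCP by (force simp: encode_pair_in_pcp_verifier)
  qed
  then show ?thesis unfolding class_NP_def using pcp_verifier_in_P by blast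
qed

section \<open>From 3-CNF formulas to partition coloring\<close>

lemma encode_nat_append_eq: "encode_nat a @ u = encode_nat b @ v \<longleftrightarrow> a = b \<and> u = v"
proof (induction a arbitrary: b)
  case 0
  then show ?case by (cases b) (auto simp: encode_nat_def)
next
  case (Suc a)
  then show ?case by (cases b) (auto simp: encode_nat_def)
qed

lemma encode_edge_append_eq: "encode_edge e @ u = encode_edge f @ v \<longleftrightarrow> e = f \<and> u = v"
  by (cases e; cases f) (auto simp: encode_edge_def encode_nat_append_eq)

lemma encode_list_Nil: "encode_list enc [] = [False]"
  by (simp add: encode_list_def)

lemma encode_list_Cons: "encode_list enc (x # xs) = True # enc x @ encode_list enc xs"
  by (simp add: encode_list_def)

text \<open>Allowing arbitrary rests \<open>u\<close> and \<open>v\<close> makes the property pass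
  from items to lists, hence to lists of lists.\<close>

lemma encode_list_append_eq:
  assumes "\<And>x y u v. enc x @ u = enc y @ v \<longleftrightarrow> x = y \<and> u = v"
  shows "encode_list enc xs @ u = encode_list enc ys @ v \<longleftrightarrow> xs = ys \<and> u = v"
proof (induction xs arbitrary: ys)
  case Nil
  then show ?case by (cases ys) (auto simp: encode_list_Nil encode_list_Cons)
next
  case (Cons x xs)
  then show ?case by (cases ys) (auto simp: encode_list_Nil encode_list_Cons assms)
qed

text \<open>The language quantifies over all instances with a given code; injectivity is what allows
  membership of a constructed code to be judged by the constructed instance alone.\<close>

lemma encode_instance_inject:
  assumes "encode_instance n k es ps = encode_instance n' k es' ps'"
  shows "n = n' \<and> es = es' \<and> ps = ps'"
proof -
  have 1: "encode_list encode_nat p @ u = encode_list encode_nat p' @ v \<longleftrightarrow> p = p'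
      \<and> u = v" for p p' u v
    by (rule encode_list_append_eq) (rule encode_nat_append_eq)
  have 2: "encode_list encode_edge es @ u = encode_list encode_edge es' @ v \<longleftrightarrow> es = es'
      \<and> u = v" for u v
    by (rule encode_list_append_eq) (rule encode_edge_append_eq)
  have 3: "encode_list (encode_list encode_nat) ps @ u = encode_list (encode_list encode_nat) ps' @
      v \<longleftrightarrow> ps = ps' \<and> u = v" for u v
    by (rule encode_list_append_eq) (rule 1)
  from assms show ?thesis
    unfolding encode_instance_def encode_nat_append_eq 2 using 3[of "[]" "[]"] by simp
qed

definition pos :: "nat \<Rightarrow> nat" where "pos v = 2 * v"
definition neg :: "nat \<Rightarrow> nat" where "neg v = Suc (2 * v)"

definition lit_true :: "(nat \<Rightarrow> bool) \<Rightarrow> nat \<Rightarrow> bool" where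
  "lit_true \<alpha> l \<longleftrightarrow> (if even l then \<alpha> (l div 2) else \<not> \<alpha> (l div 2))"

lemma lit_true_pos [simp]: "lit_true \<alpha> (pos v) \<longleftrightarrow> \<alpha> v"
  and lit_true_neg [simp]: "lit_true \<alpha> (neg v) \<longleftrightarrow> \<not> \<alpha> v"
  by (simp_all add: lit_true_def pos_def neg_def)

lemma literal_cases: obtains v where "l = pos v" | v where "l = neg v"
  by (metis evenE oddE pos_def neg_def Suc_eq_plus1)

text \<open>Every clause has three slots, and literals may repeat, which is how unit and binary
  clauses are represented.\<close>

definition satisfiable :: "nat \<Rightarrow> (nat \<Rightarrow> nat \<Rightarrow> nat) \<Rightarrow> bool" where
  "satisfiable N L \<longleftrightarrow> (\<exists>\<alpha>. \<forall>c<N. \<exists>s<3. lit_true \<alpha> (L c s))"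

text \<open>The bounded quantifier keeps the relation definable. The fixed order, positive literal
  first, lists each conflict edge in one direction only.\<close>

definition opposite :: "nat \<Rightarrow> nat \<Rightarrow> bool" where
  "opposite l l' \<longleftrightarrow> (\<exists>v<Suc l. l = pos v \<and> l' = neg v)"

lemma opposite_iff: "opposite l l' \<longleftrightarrow> (\<exists>v. l = pos v \<and> l' = neg v)"
  unfolding opposite_def pos_def by auto

definition cnf_edges :: "nat \<Rightarrow> (nat \<Rightarrow> nat \<Rightarrow> nat) \<Rightarrow> (nat \<times> nat) list" where
  "cnf_edges N L = concat (map (\<lambda>c. concat (map (\<lambda>s. concat (map (\<lambda>c'. concat (map (\<lambda>s'.
     if opposite (L c s) (L c' s') then [(3 * c + s, 3 * c' + s')] else [])
     [0..<3])) [0..<N])) [0..<3])) [0..<N])"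

definition cnf_parts :: "nat \<Rightarrow> nat \<Rightarrow> nat list list" where
  "cnf_parts q N = map (\<lambda>c. map (\<lambda>s. 3 * c + s) [0..<3]) [0..<N] @ [map (\<lambda>i. 3 * N + i) [0..<q]]"

definition cnf_pcp :: "nat \<Rightarrow> nat \<Rightarrow> (nat \<Rightarrow> nat \<Rightarrow> nat) \<Rightarrow> bool list" where
  "cnf_pcp q N L = encode_instance (3 * N + q) 1 (cnf_edges N L) (cnf_parts q N)"

lemma set_cnf_edges: "(u, v) \<in> set (cnf_edges N L) \<longleftrightarrow>
    (\<exists>c<N. \<exists>s<3. \<exists>c'<N. \<exists>s'<3. opposite (L c s) (L c' s') \<and> u = 3 * c + s \<and> v = 3 * c' + s')"
  unfolding cnf_edges_def by (fastforce split: if_splits)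

lemma concat_cnf_parts: "concat (cnf_parts q N) = [0..<3 * N + q]"
proof -
  have *: "map (\<lambda>i. a + i) [0..<m] = [a..<a + m]" for a m :: nat
    by (auto intro!: nth_equalityI)
  have "concat (map (\<lambda>c. map (\<lambda>s. 3 * c + s) [0..<3]) [0..<N]) = [0..<3 * N]"
  proof (induction N)
    case (Suc N)
    have "[0..<3 * Suc N] = [0..<3 * N] @ [3 * N..<3 * N + 3]"
      using upt_add_eq_append[of 0 "3 * N" 3] by (simp add: algebra_simps)
    moreover have "[0..<Suc N] = [0..<N] @ [N]" by simp
    ultimately show ?case using Suc by (simp add: * del: upt_Suc)
  qed simp
  then show ?thesis unfolding cnf_parts_def
    using upt_add_eq_append[of 0 "3 * N" q] by (simp add: *)
qed

lemma vertex_inject: "s < 3 \<Longrightarrow> s' < 3 \<Longrightarrow> 3 * c + s = 3 * c' + s' \<Longrightarrow> c = c'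
    \<and> s = s'" for s s' c c' :: nat
  by presburger

lemma cnf_pcp_in_PCP_iff:
  assumes "3 \<le> q"
  shows "cnf_pcp q N L \<in> PCP_restricted 1 q \<longleftrightarrow> satisfiable N L"
proof -
  let ?n = "3 * N + q" and ?es = "cnf_edges N L" and ?ps = "cnf_parts q N"
  let ?part = "\<lambda>c. {3 * c, 3 * c + 1, 3 * c + 2}"
  have part: "set (map (\<lambda>s. 3 * c + s) [0..<3]) = ?part c" for c :: nat
    by (auto simp: numeral_3_eq_3)
  have sel: "(\<forall>p\<in>set ?ps. card (S \<inter> set p) = 1) \<longleftrightarrow>
      (\<forall>c<N. card (S \<inter> ?part c) = 1) \<and> card (S \<inter> {3 * N..<?n}) = 1" for S
  proof -
    have 1: "set (map (\<lambda>i. 3 * N + i) [0..<q]) = {3 * N..<?n}" by (auto simp: image_iff)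
    have 2: "(\<forall>p\<in>set ?ps. Q (set p)) \<longleftrightarrow>
        (\<forall>c<N. Q (set (map (\<lambda>s. 3 * c + s) [0..<3]))) \<and> Q (set (map (\<lambda>i. 3 * N + i) [0..<q]))" for Q
      by (auto simp: cnf_parts_def)
    show ?thesis using 2[of "\<lambda>A. card (S \<inter> A) = 1"] unfolding part 1 .
  qed
  have edges: "u < ?n \<and> v < ?n \<and> u \<noteq> v" if uv: "(u, v) \<in> set ?es" for u v
  proof -
    obtain c s c' s' where *: "c < N" "s < 3" "c' < N" "s' < 3" "opposite (L c s) (L c' s')"
      "u = 3 * c + s" "v = 3 * c' + s'" using uv unfolding set_cnf_edges by blast
    have "u \<noteq> v"
    proof
      assume "u = v"
      then have "c = c'" "s = s'" using vertex_inject[of s s' c c'] * by auto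
      \<comment> \<open>One literal would be both positive and negative; its value under the
        constantly true assignment tells the two apart.\<close>
      then show False using *(5) by (auto simp: opposite_iff dest: arg_cong[of _ _
          "lit_true (\<lambda>_. True)"])
    qed
    then show ?thesis using * by auto
  qed
  have "cnf_pcp q N L \<in> PCP_restricted 1 q \<longleftrightarrow> distinct (concat ?ps) \<and>
     pcp_instance {..<?n} (edge_set ?es) (part_set ?ps) \<and>
     has_max_part_size (part_set ?ps) q \<and>
     pcp_solvable {..<?n} (edge_set ?es) (part_set ?ps) 1"
    unfolding PCP_restricted_def cnf_pcp_def mem_Collect_eq using encode_instance_inject by metis
  also have "\<dots> \<longleftrightarrow> (\<exists>S. S \<subseteq> {..<?n} \<and> (\<forall>p\<in>set ?ps. card (S \<inter> set p) = 1) \<and> (\<forall>(u, v)\<in>set ?es. u \<notin> S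
      \<or> v \<notin> S))"
  proof -
    \<comment> \<open>Clause parts have size \<open>3\<close>, so \<open>3 \<le> q\<close> makes the
      extra part of size \<open>q\<close> the largest one.\<close>
    have "[] \<notin> set ?ps" "\<forall>p\<in>set ?ps. length p \<le> q" "\<exists>p\<in>set ?ps. length p = q"
      using assms by (auto simp: cnf_parts_def)
    moreover have "set (concat ?ps) = {..<?n}" "distinct (concat ?ps)" unfolding concat_cnf_parts
        by auto
    ultimately show ?thesis unfolding pcp_yes_iff using edges by blast
  qed
  also have "\<dots> \<longleftrightarrow> satisfiable N L"
  proof
    assume "\<exists>S. S \<subseteq> {..<?n} \<and> (\<forall>p\<in>set ?ps. card (S \<inter> set p) = 1) \<and> (\<forall>(u, v)\<in>set ?es. u \<notin> S \<or> v \<notin> S)"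
    then obtain S where S: "\<And>c. c < N \<Longrightarrow> card (S \<inter> ?part c) = 1" and ind:
        "\<And>u v. (u, v) \<in> set ?es \<Longrightarrow> u \<notin> S \<or> v \<notin> S"
      unfolding sel by blast
    \<comment> \<open>A variable is true exactly when a positive occurrence is selected. A selected
      negative occurrence then stays true, since it is adjacent to every positive occurrence of its
      variable.\<close>
    define \<alpha> where "\<alpha> v \<longleftrightarrow> (\<exists>c<N. \<exists>s<3. 3 * c + s \<in> S \<and> L c s = pos v)" for v
    have "\<exists>s<3. lit_true \<alpha> (L c s)" if c: "c < N" for c
    proof -
      from S[OF c] obtain i where "i \<in> S" "i \<in> ?part c" by (metis IntE card_1_singletonE insertI1)
      then have "\<exists>s<3. 3 * c + s \<in> S"
        by (auto intro: exI[of _ 0] exI[of _ 1] exI[of _ 2])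
      then obtain s where s: "s < 3" "3 * c + s \<in> S" by blast
      have "lit_true \<alpha> (L c s)"
      proof (cases "L c s" rule: literal_cases)
        case (1 v)
        then show ?thesis using c s by (auto simp: \<alpha>_def)
      next
        case (2 v)
        have "\<not> \<alpha> v"
        proof
          assume "\<alpha> v"
          then obtain c' s' where *: "c' < N" "s' < 3" "3 * c' + s' \<in> S" "L c' s' = pos v"
              by (auto simp: \<alpha>_def)
          then have "(3 * c' + s', 3 * c + s) \<in> set ?es" using c s 2
              unfolding set_cnf_edges opposite_iff by blast
          then show False using ind * s by blast
        qed
        then show ?thesis using 2 by simp
      qed
      then show ?thesis using s by blast
    qed
    then show "satisfiable N L" unfolding satisfiable_def by blast
  next
    assume "satisfiable N L"
    then obtain \<alpha> where "\<And>c. c < N \<Longrightarrow> \<exists>s<3. lit_true \<alpha> (L c s)" unfolding satisfiable_def by blast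
    then obtain f where f: "\<And>c. c < N \<Longrightarrow> f c < 3 \<and> lit_true \<alpha> (L c (f c))" by metis
    \<comment> \<open>One true literal is taken per clause, and \<open>3 * N\<close> is the first of
      the isolated vertices of the extra part.\<close>
    define S where "S = insert (3 * N) ((\<lambda>c. 3 * c + f c) ` {..<N})"
    have mem: "3 * c + s \<in> S \<longleftrightarrow> f c = s" if "c < N" "s < 3" for c s
    proof
      have "3 * c + s \<noteq> 3 * N" using that by linarith
      moreover assume "3 * c + s \<in> S"
      ultimately obtain c' where "c' < N" "3 * c + s = 3 * c' + f c'" by (auto simp: S_def)
      moreover from this have "c = c'" using vertex_inject[of s "f c'" c c'] f[of c'] that by blast
      ultimately show "f c = s" by simp
    qed (use that in \<open>auto simp: S_def\<close>)
    have "S \<inter> ?part c = {3 * c + f c}" if "c < N" for c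
    proof -
      have m: "3 * c \<in> S \<longleftrightarrow> f c = 0" "3 * c + 1 \<in> S \<longleftrightarrow> f c = 1" "3 * c + 2 \<in> S \<longleftrightarrow> f c = 2"
        using mem[OF that, of 0] mem[OF that, of 1] mem[OF that, of 2] by simp_all
      have "f c < 3" using f[OF that] by blast
      then consider "f c = 0" | "f c = 1" | "f c = 2" by linarith
      then show ?thesis using m by cases auto
    qed
    moreover have "S \<inter> {3 * N..<?n} = {3 * N}"
    proof -
      have "3 * c + f c < 3 * N" if "c < N" for c using f[OF that] that by simp
      then have "S \<inter> {3 * N..<?n} \<subseteq> {3 * N}" by (auto simp: S_def not_less[symmetric])
      moreover have "3 * N \<in> S \<inter> {3 * N..<?n}" using assms by (simp add: S_def)
      ultimately show ?thesis by blast
    qed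
    moreover have "S \<subseteq> {..<?n}"
    proof -
      have "3 * c + f c < ?n" if "c < N" for c using f[OF that] that by simp
      then show ?thesis using assms by (auto simp: S_def)
    qed
    moreover have "u \<notin> S \<or> v \<notin> S" if uv: "(u, v) \<in> set ?es" for u v
    proof (rule ccontr)
      assume *: "\<not> (u \<notin> S \<or> v \<notin> S)"
      obtain c s c' s' where cs: "c < N" "s < 3" "c' < N" "s' < 3" "opposite (L c s) (L c' s')"
        "u = 3 * c + s" "v = 3 * c' + s'" using uv unfolding set_cnf_edges by blast
      then have "f c = s" "f c' = s'" using * mem by auto
      then have "lit_true \<alpha> (L c s)" "lit_true \<alpha> (L c' s')" using f[of c] f[of c'] cs by auto
      then show False using cs(5) by (auto simp: opposite_iff)
    qed
    ultimately show "\<exists>S. S \<subseteq> {..<?n} \<and> (\<forall>p\<in>set ?ps. card (S \<inter> set p) = 1)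
        \<and> (\<forall>(u, v)\<in>set ?es. u \<notin> S \<or> v \<notin> S)"
      unfolding sel by (intro exI[of _ S]) auto
  qed
  finally show ?thesis .
qed

text \<open>Without the end mark, list encoding respects concatenation, so it can be pushed through
  the nested loops that produce edges and parts.\<close>

definition items :: "('a \<Rightarrow> bool list) \<Rightarrow> 'a list \<Rightarrow> bool list" where
  "items enc xs = concat (map (\<lambda>x. True # enc x) xs)"

lemma items_Nil: "items enc [] = []"
  and items_Cons: "items enc (x # xs) = True # enc x @ items enc xs"
  and items_append: "items enc (xs @ ys) = items enc xs @ items enc ys"
  and items_if: "items enc (if P then xs else ys) = (if P then items enc xs else items enc ys)"
  and items_map: "items enc (map f zs) = concat (map (\<lambda>z. True # enc (f z)) zs)"
  and encode_list_items: "encode_list enc xs = items enc xs @ [False]"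
  by (simp_all add: items_def encode_list_def comp_def)

lemma items_concat: "items enc (concat (map G zs)) = concat (map (\<lambda>z. items enc (G z)) zs)"
  by (induction zs) (simp_all add: items_Nil items_append)

lemma num_pos [closure]: "num f \<Longrightarrow> num (\<lambda>x \<rho>. pos (f x \<rho>))"
  unfolding pos_def by (intro closure)

lemma num_neg [closure]: "num f \<Longrightarrow> num (\<lambda>x \<rho>. neg (f x \<rho>))"
  unfolding neg_def by (intro closure)

lemma prd_opposite [closure]:
  assumes "num f" "num g"
  shows "prd (\<lambda>x \<rho>. opposite (f x \<rho>) (g x \<rho>))"
proof -
  have "num (\<lambda>x \<rho>. of_bool (opposite (\<rho> 0) (\<rho> 1)))" unfolding opposite_def by (intro closure)
  from num2[OF this assms] show ?thesis by (simp add: prd_def)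
qed

lemma polytime_cnf_pcp:
  assumes "num (\<lambda>x \<rho>. N x)" "num (\<lambda>x \<rho>. L x (\<rho> 0) (\<rho> 1))"
  shows "polytime (\<lambda>x. cnf_pcp q (N x) (L x))"
proof -
  note L = num2[of L, OF assms(2)]
  have "str (\<lambda>x \<rho>. cnf_pcp q (N x) (L x))"
    unfolding cnf_pcp_def cnf_edges_def cnf_parts_def encode_instance_def encode_list_items
        items_concat items_if
      items_append items_map items_Cons items_Nil encode_edge_def fst_conv snd_conv
    by (intro closure assms(1) L)
  from polytime_str[OF this] show ?thesis .
qed

section \<open>The tableau of a polynomial-time verifier\<close>

text \<open>The three arguments are packed into one code, which reduces the claim to a finite table
  in one variable.\<close>

lemma num_table3 [closure]:
  assumes "num a" "num b" "num c"
  shows "num (\<lambda>x \<rho>. if list_encode [a x \<rho>, b x \<rho>, c x \<rho>] < m then h (a x \<rho>) (b x \<rho>) (c x \<rho>) else 0)"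
proof -
  have "num (\<lambda>x \<rho>. list_encode [a x \<rho>, b x \<rho>, c x \<rho>])" by (intro closure assms)
  from num_table[OF this, of m "\<lambda>e. h (list_decode e ! 0) (list_decode e ! 1) (list_decode e ! 2)"]
  show ?thesis by (simp only: list_encode_inverse nth_Cons_0 nth_Cons_Suc One_nat_def
      numeral_2_eq_2)
qed

text \<open>
  \<open>head t j c\<close>: at time \<open>t\<close> the head of tape \<open>j\<close> is in cell \<open>c\<close>; \<open>cell t j c a\<close>: that cell contains
  \<open>a\<close>; \<open>scan t j a\<close>: the head of tape \<open>j\<close> reads \<open>a\<close>; \<open>seen t j s r\<close>: the state is \<open>s\<close> and \<open>r\<close> codes
  the symbols read on the first \<open>j\<close> tapes, last one first.
\<close>

definition head_var :: "nat \<Rightarrow> nat \<Rightarrow> nat \<Rightarrow> nat" where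
  "head_var t j c = list_encode [1, t, j, c]"
definition cell_var :: "nat \<Rightarrow> nat \<Rightarrow> nat \<Rightarrow> nat \<Rightarrow> nat" where
  "cell_var t j c a = list_encode [2, t, j, c, a]"
definition scan_var :: "nat \<Rightarrow> nat \<Rightarrow> nat \<Rightarrow> nat" where
  "scan_var t j a = list_encode [3, t, j, a]"
definition seen_var :: "nat \<Rightarrow> nat \<Rightarrow> nat \<Rightarrow> nat \<Rightarrow> nat" where
  "seen_var t j s r = list_encode [4, t, j, s, r]"

lemmas var_defs = head_var_def cell_var_def scan_var_def seen_var_def

definition slots :: "nat \<Rightarrow> nat \<Rightarrow> nat \<Rightarrow> nat \<Rightarrow> nat" where
  "slots l0 l1 l2 s = (if s = 0 then l0 else if s = 1 then l1 else l2)"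

lemma slots_simps [simp]: "slots l0 l1 l2 0 = l0" "slots l0 l1 l2 1 = l1"
    "slots l0 l1 l2 (Suc 0) = l1" "slots l0 l1 l2 2 = l2"
  by (simp_all add: slots_def)

lemma ex_less_3: "(\<exists>s<3. Q s) \<longleftrightarrow> Q 0 \<or> Q 1 \<or> Q (2 :: nat)"
  by (auto simp: numeral_3_eq_3 numeral_2_eq_2 less_Suc_eq)

locale tableau =
  fixes k g :: nat and M :: machine and time_poly wit_poly :: "nat poly"
  assumes tm: "turing_machine k g M"
begin

section \<open>Runs of the verifier, tape by tape\<close>

definition transition :: "nat \<Rightarrow> nat list \<Rightarrow> nat \<times> (nat \<times> direction) list" where
  "transition s rs = (if s < length M then (M ! s) rs else (s, map (\<lambda>a. (a, Stay)) rs))"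

definition run :: "bool list \<Rightarrow> nat \<Rightarrow> config" where
  "run y t = (step M ^^ t) (init_config k y)"

definition st :: "bool list \<Rightarrow> nat \<Rightarrow> nat" where "st y t = fst (run y t)"
definition tp :: "bool list \<Rightarrow> nat \<Rightarrow> nat \<Rightarrow> tape" where "tp y t j = snd (run y t) ! j"
definition rd :: "bool list \<Rightarrow> nat \<Rightarrow> nat list" where "rd y t = map read_tape (snd (run y t))"

lemma k_ge_2: "2 \<le> k" and g_ge_3: "3 \<le> g"
  using tm by (auto simp: turing_machine_def)

lemma transition_wf:
  assumes "s \<le> length M" "length rs = k" "set rs \<subseteq> {..<g}"
  shows "fst (transition s rs) \<le> length M" "length (snd (transition s rs)) = k"
    and "\<And>j. j < k \<Longrightarrow> fst (snd (transition s rs) ! j) < g"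
proof -
  have *: "fst (transition s rs) \<le> length M \<and> length (snd (transition s rs)) = k
      \<and> fst ` set (snd (transition s rs)) \<subseteq> {..<g}"
  proof (cases "s < length M")
    case True
    then have "M ! s \<in> set M" by simp
    with tm have "\<forall>rs. length rs = k \<and> set rs \<subseteq> {..<g} \<longrightarrow>
        (case (M ! s) rs of (s, as) \<Rightarrow> s \<le> length M \<and> length as = k \<and> fst ` set as \<subseteq> {..<g})"
      unfolding turing_machine_def by (elim conjE) (drule bspec, assumption, assumption)
    then have "case (M ! s) rs of (s, as) \<Rightarrow> s \<le> length M \<and> length as = k \<and> fst ` set as \<subseteq> {..<g}"
      using assms(2,3) by simp
    then show ?thesis using True by (simp add: transition_def case_prod_beta)
  qed (use assms in \<open>auto simp: transition_def\<close>)
  then show "fst (transition s rs) \<le> length M" "length (snd (transition s rs)) = k" by auto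
  show "fst (snd (transition s rs) ! j) < g" if "j < k" for j
    using * that by (metis image_subset_iff lessThan_iff nth_mem)
qed

text \<open>In the halting state \<open>transition\<close> rewrites the scanned symbols and moves no
  head, so clauses need no case for halted configurations.\<close>

lemma step_transition:
  "step M (s, ts) = (fst (transition s (map read_tape ts)), map2 act (snd (transition s (map
      read_tape ts))) ts)"
proof (cases "s < length M")
  case False
  have "map2 act (map (\<lambda>a. (a, Stay)) (map read_tape ts)) ts = ts"
    by (rule nth_equalityI) (auto simp: act_idle)
  then show ?thesis using False by (simp add: transition_def)
qed (simp add: transition_def split: prod.splits)

lemma run_Suc: "run y (Suc t) = (fst (transition (st y t) (rd y t)), map2 act (snd (transition (st y
    t) (rd y t))) (snd (run y t)))"
  using step_transition[of "fst (run y t)" "snd (run y t)"]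
      by (simp add: run_def st_def rd_def del: step.simps)

lemma run_0: "st y 0 = 0" "j < k \<Longrightarrow> tp y 0 j = (if j = 0 then contents y else contents [], 0)"
  by (cases j; auto simp: st_def tp_def run_def init_config_def)+

text \<open>A head moves by at most one cell per step, hence up to time \<open>t\<close> it stays
  within distance \<open>t\<close> of cell \<open>0\<close>. This justifies shifting all cells by
  \<open>T x\<close> to natural indices.\<close>

lemma run_wf:
  "length (snd (run y t)) = k \<and> st y t \<le> length M \<and>
   (\<forall>j<k. \<bar>snd (tp y t j)\<bar> \<le> int t \<and> (\<forall>i. fst (tp y t j) i < g))"
proof (induction t)
  case 0
  have "contents z i < g" for z i using g_ge_3 by (auto simp: contents_def)
  then show ?case using k_ge_2 by (auto simp: run_0) (simp add: run_def init_config_def)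
next
  case (Suc t)
  have rd: "length (rd y t) = k" "set (rd y t) \<subseteq> {..<g}"
  proof -
    show "length (rd y t) = k" using Suc by (simp add: rd_def)
    show "set (rd y t) \<subseteq> {..<g}"
    proof
      fix a assume "a \<in> set (rd y t)"
      then obtain j where "j < k" "a = read_tape (tp y t j)" using Suc
          by (auto simp: rd_def tp_def in_set_conv_nth)
      then show "a \<in> {..<g}" using Suc by (simp add: read_tape_def)
    qed
  qed
  note wf = transition_wf[OF conjunct1[OF conjunct2[OF Suc]] rd]
  have "\<bar>snd (tp y (Suc t) j)\<bar> \<le> int (Suc t) \<and> (\<forall>i. fst (tp y (Suc t) j) i < g)" if "j < k" for j
  proof -
    obtain c h where ch: "tp y t j = (c, h)" by fastforce
    obtain a d where ad: "snd (transition (st y t) (rd y t)) ! j = (a, d)" by fastforce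
    have "tp y (Suc t) j = act (a, d) (c, h)"
      using that wf(2) Suc ad ch by (simp add: tp_def run_Suc)
    moreover have "\<bar>h\<bar> \<le> int t" "\<And>i. c i < g" using Suc that ch by fastforce+
    moreover have "a < g" using wf(3)[OF that] ad by simp
    moreover have "\<bar>offset d\<bar> \<le> 1" by (cases d) auto
    ultimately show ?thesis by auto
  qed
  then show ?case using wf Suc by (simp add: st_def run_Suc)
qed

lemma st_le: "st y t \<le> length M"
  and head_le: "j < k \<Longrightarrow> \<bar>snd (tp y t j)\<bar> \<le> int t"
  and cell_less: "j < k \<Longrightarrow> fst (tp y t j) i < g"
  using run_wf[of y t] by auto

lemma length_rd: "length (rd y t) = k"
  using run_wf[of y t] by (simp add: rd_def)

lemma rd_nth: "j < k \<Longrightarrow> rd y t ! j = fst (tp y t j) (snd (tp y t j))"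
  using run_wf[of y t] by (simp add: rd_def tp_def read_tape_def)

lemma rd_less: "set (rd y t) \<subseteq> {..<g}"
  using rd_nth cell_less by (fastforce simp: in_set_conv_nth length_rd)

lemma st_Suc: "st y (Suc t) = fst (transition (st y t) (rd y t))"
  by (simp add: st_def[of y "Suc t"] run_Suc)

lemma tp_Suc: "j < k \<Longrightarrow> tp y (Suc t) j = act (snd (transition (st y t) (rd y t)) ! j) (tp y t j)"
  using run_wf[of y t] transition_wf(2)[OF st_le length_rd rd_less]
  by (simp add: tp_def run_Suc)

text \<open>States, symbol lists and tapes form a finite set; beyond the largest code the tables
  below are cut off, which makes them definable. Shorter lists are included because symbols are
  collected one tape at a time.\<close>

definition code_bound :: nat where
  "code_bound = Suc (Max ((\<lambda>(s, rs, j). list_encode [s, list_encode rs, j]) `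
     ({..length M} \<times> {rs. set rs \<subseteq> {..<g} \<and> length rs \<le> k} \<times> {..k})))"

lemma less_code_bound:
  assumes "s \<le> length M" "set rs \<subseteq> {..<g}" "length rs \<le> k" "j \<le> k"
  shows "list_encode [s, list_encode rs, j] < code_bound" "list_encode rs < code_bound"
proof -
  let ?A = "{..length M} \<times> {rs. set rs \<subseteq> {..<g} \<and> length rs \<le> k} \<times> {..k}"
  have "finite ?A" by (simp add: finite_lists_length_le)
  moreover have "(s, rs, j) \<in> ?A" using assms by simp
  ultimately show *: "list_encode [s, list_encode rs, j] < code_bound"
    unfolding code_bound_def less_Suc_eq_le
    by (intro Max_ge finite_imageI image_eqI[of _ _ "(s, rs, j)"]) simp_all
  have "list_encode rs \<le> prod_encode (list_encode rs, list_encode [j])" by (rule le_prod_encode_1)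
  also have "\<dots> \<le> list_encode [list_encode rs, j]" by simp
  also have "\<dots> \<le> prod_encode (s, list_encode [list_encode rs, j])" by (rule le_prod_encode_2)
  also have "\<dots> \<le> list_encode [s, list_encode rs, j]" by simp
  finally show "list_encode rs < code_bound" using * by simp
qed

definition next_state :: "nat \<Rightarrow> nat \<Rightarrow> nat" where
  "next_state s r = (if list_encode [s, r, 0] < code_bound then fst (transition s (rev (list_decode
      r))) else 0)"
definition written_symbol :: "nat \<Rightarrow> nat \<Rightarrow> nat \<Rightarrow> nat" where
  "written_symbol s r j =
     (if list_encode [s, r, j] < code_bound then fst (snd (transition s (rev (list_decode r))) ! j)
         else 0)"
text \<open>The offset is stored increased by one, as \<open>0\<close>, \<open>1\<close> or
  \<open>2\<close>, to remain a natural number.\<close>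

definition move :: "nat \<Rightarrow> nat \<Rightarrow> nat \<Rightarrow> nat" where
  "move s r j =
     (if list_encode [s, r, j] < code_bound then nat (offset (snd (snd (transition s (rev
         (list_decode r))) ! j)) + 1) else 0)"

lemma table_values:
  defines "r \<equiv> \<lambda>y t. list_encode (rev (rd y t))"
  shows "next_state (st y t) (r y t) = st y (Suc t)"
    and "j < k \<Longrightarrow> written_symbol (st y t) (r y t) j = fst (snd (transition (st y t) (rd y t)) ! j)"
    and "j < k \<Longrightarrow> int (move (st y t) (r y t) j) = offset (snd (snd (transition (st y t) (rd y t)) !
        j)) + 1"
proof -
  have *: "list_encode [st y t, r y t, j] < code_bound" if "j \<le> k" for j
    unfolding r_def using that st_le rd_less length_rd by (intro less_code_bound(1)) auto
  have "0 \<le> offset d + 1" for d by (cases d) auto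
  then show "next_state (st y t) (r y t) = st y (Suc t)"
    and "j < k \<Longrightarrow> written_symbol (st y t) (r y t) j = fst (snd (transition (st y t) (rd y t)) ! j)"
    and "j < k \<Longrightarrow> int (move (st y t) (r y t) j) = offset (snd (snd (transition (st y t) (rd y t)) !
        j)) + 1"
    using *[of j] *[of 0]
    by (simp_all add: next_state_def written_symbol_def move_def st_Suc r_def del:
        list_encode.simps)
qed

text \<open>The cell with index \<open>c\<close> of the tableau is the tape cell \<open>c - T x\<close>.\<close>

definition W :: "bool list \<Rightarrow> nat" where "W x = poly wit_poly (length x)"
text \<open>\<open>2 * length x + 1 + W x\<close> is the largest length of an encoded pair with an
  admissible certificate. If \<open>time_poly\<close> bounds the running time, all these runs have
  halted at time \<open>T x\<close>.\<close>

definition T :: "bool list \<Rightarrow> nat" where "T x = poly time_poly (2 * length x + 1 + W x)"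
text \<open>The index of the first certificate cell: the shift \<open>T x\<close>, two cells per
  input bit, and the separator.\<close>

definition base :: "bool list \<Rightarrow> nat" where "base x = T x + 2 * length x + 1"

text \<open>Initial contents outside the certificate: \<open>encode_pair x []\<close> is the common
  prefix of all encoded pairs with first component \<open>x\<close>.\<close>

definition fixed_input :: "bool list \<Rightarrow> nat \<Rightarrow> nat \<Rightarrow> nat" where
  "fixed_input x j c = (if j = 0 \<and> T x \<le> c then contents (encode_pair x []) (int (c - T x)) else 0)"

text \<open>
  Kinds 0 to 3 describe the initial configuration, with a free choice of the certificate, kinds
  4 to 9 force the facts about time \<open>t + 1\<close> from those about time \<open>t\<close>, and kind 10 forbids the
  output \<open>[False]\<close>. All other clauses are made true by the variable \<open>0\<close>.
\<close>

definition literal :: "bool list \<Rightarrow> nat \<Rightarrow> nat \<Rightarrow> nat \<Rightarrow> nat \<Rightarrow> nat \<Rightarrow> nat \<Rightarrow> nat \<Rightarrow> nat" where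
  "literal x kind t j c d a s =
    (if kind = 0 then pos (seen_var 0 0 0 0)
     else if kind = 1 \<and> j < k then pos (head_var 0 j (T x))
     else if kind = 2 \<and> j = 0 \<and> base x \<le> c \<and> c < base x + W x then pos (cell_var 0 0 c s)
     else if kind = 2 \<and> j < k then pos (cell_var 0 j c (fixed_input x j c))
     else if kind = 3 \<and> base x \<le> c then
       slots (neg (cell_var 0 0 c 0)) (neg (cell_var 0 0 c 0)) (pos (cell_var 0 0 (Suc c) 0)) s
     else if kind = 4 then
       slots (neg (head_var t j c)) (neg (cell_var t j c a)) (pos (scan_var t j a)) s
     else if kind = 5 then
       slots (neg (seen_var t j c d)) (neg (scan_var t j a)) (pos (seen_var t (Suc j) c (Suc
           (prod_encode (a, d))))) s
     else if kind = 6 then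
       slots (neg (seen_var t k c d)) (neg (seen_var t k c d)) (pos (seen_var (Suc t) 0 (next_state
           c d) 0)) s
     else if kind = 7 \<and> t < T x then
       slots (neg (seen_var t k d a)) (neg (head_var t j c)) (pos (head_var (Suc t) j (c + move d a
           j - 1))) s
     else if kind = 8 then
       slots (neg (seen_var t k d a)) (neg (head_var t j c)) (pos (cell_var (Suc t) j c
           (written_symbol d a j))) s
     else if kind = 9 \<and> c \<noteq> d then
       slots (neg (head_var t j c)) (neg (cell_var t j d a)) (pos (cell_var (Suc t) j d a)) s
     else if kind = 10 then neg (cell_var (T x) 1 (T x) 1)
     else pos 0)"

text \<open>One crude bound serves all six coordinates of a clause: \<open>10\<close> covers the
  kinds, \<open>2 * T x\<close> times and head positions, \<open>base x + W x\<close> the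
  certificate cells, \<open>code_bound\<close> the codes of symbols read.\<close>

definition bound :: "bool list \<Rightarrow> nat" where
  "bound x = 2 * T x + base x + W x + k + g + length M + code_bound + 10"

definition clause_count :: "bool list \<Rightarrow> nat" where
  "clause_count x = (let b = bound x in
     Suc (prod_encode (b, prod_encode (b, prod_encode (b, prod_encode (b, prod_encode (b, b)))))))"

definition clause :: "bool list \<Rightarrow> nat \<Rightarrow> nat \<Rightarrow> nat" where
  "clause x i s =
     literal x (fst (prod_decode i)) (fst (prod_decode (snd (prod_decode i))))
       (fst (prod_decode (snd (prod_decode (snd (prod_decode i))))))
       (fst (prod_decode (snd (prod_decode (snd (prod_decode (snd (prod_decode i))))))))
       (fst (prod_decode (snd (prod_decode (snd (prod_decode (snd (prod_decode (snd (prod_decode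
           i))))))))))
       (snd (prod_decode (snd (prod_decode (snd (prod_decode (snd (prod_decode (snd (prod_decode
           i)))))))))) s"

subsection \<open>An accepting run satisfies all clauses\<close>

definition holds :: "bool list \<Rightarrow> bool list \<Rightarrow> nat \<Rightarrow> bool" where
  "holds x y v \<longleftrightarrow> v = 0 \<or>
     (\<exists>t j c. v = head_var t j c \<and> j < k \<and> int c = snd (tp y t j) + int (T x)) \<or>
     (\<exists>t j c a. v = cell_var t j c a \<and> j < k \<and> fst (tp y t j) (int c - int (T x)) = a) \<or>
     (\<exists>t j a. v = scan_var t j a \<and> j < k \<and> rd y t ! j = a) \<or>
     (\<exists>t j s r. v = seen_var t j s r \<and> j \<le> k \<and> s = st y t
         \<and> r = list_encode (rev (take j (rd y t))))"

text \<open>Tags separate the four sorts of variables, \<open>list_encode\<close> is injective, and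
  only the empty list has code \<open>0\<close>.\<close>

lemma holds_simps:
  "holds x y 0"
  "holds x y (head_var t j c) \<longleftrightarrow> j < k \<and> int c = snd (tp y t j) + int (T x)"
  "holds x y (cell_var t j c a) \<longleftrightarrow> j < k \<and> fst (tp y t j) (int c - int (T x)) = a"
  "holds x y (scan_var t j a) \<longleftrightarrow> j < k \<and> rd y t ! j = a"
  "holds x y (seen_var t j s r) \<longleftrightarrow> j \<le> k \<and> s = st y t \<and> r = list_encode (rev (take j (rd y t)))"
  by (auto simp: holds_def var_defs)

lemma contents_Nil: "contents [] i = 0"
  by (simp add: contents_def)

lemma encode_pair_split: "encode_pair x w = encode_pair x [] @ w"
  by (simp add: encode_pair_def)

lemma contents_encode_pair_base:
  assumes "base x \<le> c"
  shows "contents (encode_pair x w) (int c - int (T x)) = contents w (int (c - base x))"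
proof -
  have "int c - int (T x) = int (c - T x)" "c - T x - (2 * length x + 1) = c - base x"
    using assms by (auto simp: base_def)
  moreover have "\<not> c - T x < length (encode_pair x [])" using assms
      by (auto simp: base_def length_encode_pair)
  ultimately show ?thesis
    by (simp add: encode_pair_split[of x w] contents_append_nat length_encode_pair del: of_nat_diff)
qed

lemma contents_encode_pair_fixed:
  assumes "c < base x \<or> base x + length w \<le> c"
  shows "contents (encode_pair x w) (int c - int (T x)) = fixed_input x 0 c"
proof (cases "T x \<le> c")
  case True
  then have "int c - int (T x) = int (c - T x)" by simp
  then show ?thesis using True assms
    by (auto simp: fixed_input_def encode_pair_split[of x w] contents_append_nat length_encode_pair
        base_def
        contents_eq_0 simp del: of_nat_diff)
qed (auto simp: fixed_input_def contents_def)

text \<open>The coordinates are unrestricted: even clauses about cells or times outside the range of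
  interest are true of the actual run, so the range of clause indices is irrelevant in this
  direction.\<close>

lemma holds_clause:
  assumes "length w \<le> W x" "y = encode_pair x w" "fst (tp y (T x) 1) 0 \<noteq> 1"
  shows "\<exists>s<3. lit_true (holds x y) (literal x kind t j c d a s)"
proof -
  let ?F = "holds x y"
  have k0: "0 < k" "1 < k" using k_ge_2 by auto
  have cell0: "?F (cell_var 0 j c (fixed_input x j c))" if "j < k"
      "\<not> (j = 0 \<and> base x \<le> c \<and> c < base x + W x)"
  proof (cases "j = 0")
    case True
    then have "c < base x \<or> base x + length w \<le> c" using that assms(1) by auto
    from contents_encode_pair_fixed[OF this] show ?thesis using that True
        by (simp add: holds_simps run_0 assms(2))
  qed (use that in \<open>simp add: holds_simps run_0 fixed_input_def contents_def\<close>)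
  \<comment> \<open>From \<open>base x\<close> on the tape carries \<open>w\<close> followed by
    blanks only, so a blank there is followed by a blank.\<close>
  have blank: "?F (cell_var 0 0 (Suc c) 0)" if "?F (cell_var 0 0 c 0)" "base x \<le> c"
  proof -
    have "contents w (int (c - base x)) = 0"
      using that k0 by (simp add: holds_simps run_0 assms(2) contents_encode_pair_base)
    then have "contents w (int (Suc c - base x)) = 0" using that(2)
      by (auto simp: contents_def split: if_splits)
    then show ?thesis using that k0 contents_encode_pair_base[of x "Suc c" w]
      by (simp add: holds_simps run_0 assms(2))
  qed
  have choice: "\<exists>s<3. ?F (cell_var 0 0 c s)" if "base x \<le> c"
    using k0 that by (auto simp: holds_simps run_0 assms(2) contents_encode_pair_base contents_def)
  have scan: "?F (scan_var t j a)" if "?F (head_var t j c)" "?F (cell_var t j c a)"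
    using that by (auto simp: holds_simps rd_nth)
  have seen: "?F (seen_var t (Suc j) c (Suc (prod_encode (a, d))))" if "?F (seen_var t j c d)"
      "?F (scan_var t j a)"
    using that by (auto simp: holds_simps take_Suc_conv_app_nth length_rd)
  have state: "?F (seen_var (Suc t) 0 (next_state c d) 0)" if "?F (seen_var t k c d)"
    using that by (auto simp: holds_simps length_rd table_values)
  have head: "?F (head_var (Suc t) j (c + move d a j - 1))" if "?F (seen_var t k d a)"
      "?F (head_var t j c)" "t < T x"
  proof -
    have j: "j < k" and c: "int c = snd (tp y t j) + int (T x)" using that
        by (auto simp: holds_simps)
    have m: "int (move d a j) = offset (snd (snd (transition (st y t) (rd y t)) ! j)) + 1"
      using that j by (auto simp: holds_simps length_rd table_values)
    \<comment> \<open>Before time \<open>T x\<close> the head is strictly to the right of cell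
      \<open>- T x\<close>, so the truncated subtraction in \<open>c + move d a j - 1\<close> is
      exact.\<close>
    have "1 \<le> c" using head_le[OF j, of y t] c that(3) by linarith
    moreover have "snd (tp y (Suc t) j) = snd (tp y t j) + offset (snd (snd (transition (st y t) (rd
        y t)) ! j))"
      unfolding tp_Suc[OF j] by (cases "snd (transition (st y t) (rd y t)) ! j"; cases
          "tp y t j") simp
    ultimately show ?thesis using j c m by (simp add: holds_simps)
  qed
  have wrote: "?F (cell_var (Suc t) j c (written_symbol d a j))" if "?F (seen_var t k d a)"
      "?F (head_var t j c)"
    using that
    by (cases "snd (transition (st y t) (rd y t)) ! j"; cases
        "tp y t j") (auto simp: holds_simps length_rd table_values tp_Suc)
  have keep: "?F (cell_var (Suc t) j d a)" if "?F (head_var t j c)" "?F (cell_var t j d a)" "c \<noteq> d"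
    using that by (cases "snd (transition (st y t) (rd y t)) ! j"; cases
        "tp y t j") (auto simp: holds_simps tp_Suc)
  have reject: "\<not> ?F (cell_var (T x) 1 (T x) 1)" using assms(3) by (simp add: holds_simps)
  have init: "?F (seen_var 0 0 0 0)" "?F 0" by (auto simp: holds_simps run_0)
  have head0: "?F (head_var 0 j (T x))" if "j < k" using that by (simp add: holds_simps run_0)
  have "kind = 0 \<or> kind = 1 \<or> kind = 2 \<or> kind = 3 \<or> kind = 4 \<or> kind = 5 \<or> kind = 6 \<or>
      kind = 7 \<or> kind = 8 \<or> kind = 9 \<or> kind = 10 \<or> 10 < kind" by presburger
  then consider "kind = 0" | "kind = 1" | "kind = 2" | "kind = 3" | "kind = 4" | "kind = 5" |
      "kind = 6"
    | "kind = 7" | "kind = 8" | "kind = 9" | "kind = 10" | "10 < kind" by blast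
  then show ?thesis
  proof cases
    case 1
    then show ?thesis unfolding ex_less_3 using init by (auto simp: literal_def)
  next
    case 2
    then show ?thesis unfolding ex_less_3 using init head0 by (auto simp: literal_def)
  next
    case 3
    then show ?thesis unfolding ex_less_3 using init cell0 choice[unfolded ex_less_3]
        by (auto simp: literal_def)
  next
    case 4
    then show ?thesis unfolding ex_less_3 using init blank by (auto simp: literal_def)
  next
    case 5
    then show ?thesis unfolding ex_less_3 using scan by (auto simp: literal_def)
  next
    case 6
    then show ?thesis unfolding ex_less_3 using seen by (auto simp: literal_def)
  next
    case 7
    then show ?thesis unfolding ex_less_3 using state by (auto simp: literal_def)
  next
    case 8
    then show ?thesis unfolding ex_less_3 using init head by (auto simp: literal_def)
  next
    case 9
    then show ?thesis unfolding ex_less_3 using wrote by (auto simp: literal_def)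
  next
    case 10
    then show ?thesis unfolding ex_less_3 using init keep by (auto simp: literal_def)
  next
    case 11
    then show ?thesis unfolding ex_less_3 using reject by (auto simp: literal_def)
  next
    case 12
    then show ?thesis unfolding ex_less_3 using init by (auto simp: literal_def)
  qed
qed

lemma satisfiable_if_accepted:
  assumes "length w \<le> W x" "fst (tp (encode_pair x w) (T x) 1) 0 \<noteq> 1"
  shows "satisfiable (clause_count x) (clause x)"
  unfolding satisfiable_def clause_def using holds_clause[OF assms(1) refl assms(2)] by blast

subsection \<open>A satisfying assignment contains an accepting run\<close>

lemma literal_of_clause:
  assumes "\<forall>i<clause_count x. \<exists>s<3. lit_true \<alpha> (clause x i s)"
    and "kind \<le> bound x" "t \<le> bound x" "j \<le> bound x" "c \<le> bound x" "d \<le> bound x" "a \<le> bound x"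
  shows "\<exists>s<3. lit_true \<alpha> (literal x kind t j c d a s)"
proof -
  let ?i = "prod_encode (kind, prod_encode (t, prod_encode (j, prod_encode (c, prod_encode (d,
      a)))))"
  have "?i < clause_count x"
    unfolding clause_count_def Let_def less_Suc_eq_le using assms(2-) by (intro prod_encode_mono)
  then have "\<exists>s<3. lit_true \<alpha> (clause x ?i s)" using assms(1) by blast
  then show ?thesis by (simp add: clause_def)
qed

context
  fixes x :: "bool list" and \<alpha> :: "nat \<Rightarrow> bool"
  assumes sat: "\<forall>i<clause_count x. \<exists>s<3. lit_true \<alpha> (clause x i s)"
begin

text \<open>An assignment may put several symbols into a certificate cell. Ending at the first cell
  marked blank, or after \<open>W x\<close> cells, and preferring symbol \<open>2\<close> to
  \<open>1\<close> before that selects one certificate all of whose facts are true.\<close>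

definition wit_length :: nat where
  "wit_length = (LEAST i. i = W x \<or> \<alpha> (cell_var 0 0 (base x + i) 0))"

definition wit :: "bool list" where
  "wit = map (\<lambda>i. \<alpha> (cell_var 0 0 (base x + i) 2)) [0..<wit_length]"

lemma length_wit: "length wit \<le> W x"
  unfolding wit_def wit_length_def by (simp add: Least_le)

lemma blank_after_wit:
  assumes "wit_length \<le> i" "i < W x"
  shows "\<alpha> (cell_var 0 0 (base x + i) 0)"
  using assms
proof (induction i rule: dec_induct)
  case base
  have "wit_length = W x \<or> \<alpha> (cell_var 0 0 (base x + wit_length) 0)"
    unfolding wit_length_def by (rule LeastI[of _ "W x"]) simp
  then show ?case using base by auto
next
  case (step i)
  have "\<exists>s<3. lit_true \<alpha> (literal x 3 0 0 (base x + i) 0 0 s)"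
    using step by (intro literal_of_clause sat) (auto simp: bound_def)
  then show ?case using step by (auto simp: literal_def ex_less_3)
qed

lemma init_cells:
  assumes "j < k" "c \<le> bound x"
  shows "\<alpha> (cell_var 0 j c (fst (tp (encode_pair x wit) 0 j) (int c - int (T x))))"
proof -
  have cl: "\<exists>s<3. lit_true \<alpha> (literal x 2 0 j c 0 0 s)"
    using assms by (intro literal_of_clause sat) (auto simp: bound_def)
  show ?thesis
  proof (cases "j = 0 \<and> base x \<le> c \<and> c < base x + W x")
    case True
    define i where "i = c - base x"
    have c: "c = base x + i" "i < W x" using True by (auto simp: i_def)
    have "\<alpha> (cell_var 0 0 c (contents wit (int i)))"
    proof (cases "i < wit_length")
      case less: True
      \<comment> \<open>By minimality of \<open>wit_length\<close> the cell is not marked blank, so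
        its choice clause leaves \<open>1\<close> or \<open>2\<close>.\<close>
      then have "\<not> \<alpha> (cell_var 0 0 c 0)" using not_less_Least[OF less[unfolded wit_length_def]] c
          by simp
      moreover have "contents wit (int i) = (if \<alpha> (cell_var 0 0 c 2) then 2 else 1)"
        using less c by (simp add: contents_def wit_def)
      ultimately show ?thesis using cl True by (auto simp: literal_def ex_less_3)
    next
      case False
      then have "contents wit (int i) = 0" by (simp add: contents_def wit_def)
      then show ?thesis using blank_after_wit[of i] False c by simp
    qed
    then show ?thesis using True contents_encode_pair_base[of x c wit] assms
        by (simp add: run_0 i_def)
  next
    case False
    then have *: "\<alpha> (cell_var 0 j c (fixed_input x j c))" using cl assms
        by (auto simp: literal_def ex_less_3)
    show ?thesis
    proof (cases "j = 0")
      case True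
      show ?thesis
      proof (cases "c < base x \<or> base x + length wit \<le> c")
        case fixed: True
        from contents_encode_pair_fixed[OF this] show ?thesis using * True assms
            by (simp add: run_0)
      qed (use True False length_wit in auto)
    next
      case False
      then show ?thesis using * assms by (simp add: run_0 fixed_input_def contents_Nil)
    qed
  qed
qed

text \<open>Only one inclusion is claimed: facts of the run are true in \<open>\<alpha>\<close>,
  which may contain others. A cell depends on the cell with the same index one step earlier, so the
  range \<open>c \<le> bound x\<close> survives the induction.\<close>

lemma run_forced:
  defines "y \<equiv> encode_pair x wit"
  assumes "t \<le> T x"
  shows "\<alpha> (seen_var t 0 (st y t) 0) \<and> (\<forall>j<k. \<alpha> (head_var t j (nat (snd (tp y t j) + int (T x))))) \<and>
    (\<forall>j<k. \<forall>c\<le>bound x. \<alpha> (cell_var t j c (fst (tp y t j) (int c - int (T x)))))"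
  using assms(2)
proof (induction t)
  case 0
  have "\<exists>s<3. lit_true \<alpha> (literal x 0 0 0 0 0 0 s)" by (intro literal_of_clause sat) auto
  then have "\<alpha> (seen_var 0 0 0 0)" by (auto simp: literal_def)
  moreover have "\<alpha> (head_var 0 j (T x))" if "j < k" for j
  proof -
    have "\<exists>s<3. lit_true \<alpha> (literal x 1 0 j 0 0 0 s)"
      using that by (intro literal_of_clause sat) (auto simp: bound_def)
    then show ?thesis using that by (auto simp: literal_def)
  qed
  ultimately show ?case using init_cells by (auto simp: run_0 y_def)
next
  case (Suc t)
  have t: "t < T x" "t \<le> T x" using Suc.prems by auto
  have seen0: "\<alpha> (seen_var t 0 (st y t) 0)"
    and heads: "\<And>j. j < k \<Longrightarrow> \<alpha> (head_var t j (nat (snd (tp y t j) + int (T x))))"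
    and cells: "\<And>j c. j < k \<Longrightarrow> c \<le> bound x \<Longrightarrow> \<alpha> (cell_var t j c (fst (tp y t j) (int c - int (T x))))"
    using Suc.IH[OF t(2)] by auto
  define h where "h j = nat (snd (tp y t j) + int (T x))" for j
  have h: "int (h j) = snd (tp y t j) + int (T x)" "1 \<le> h j" "h j \<le> 2 * T x" if "j < k" for j
    using head_le[OF that, of y t] t by (auto simp: h_def)
  have rdb: "rd y t ! j < g" if "j < k" for j using that by (simp add: rd_nth cell_less)
  have scan: "\<alpha> (scan_var t j (rd y t ! j))" if j: "j < k" for j
  proof -
    have "\<exists>s<3. lit_true \<alpha> (literal x 4 t j (h j) 0 (rd y t ! j) s)"
      using j t h[OF j] rdb[OF j] by (intro literal_of_clause sat) (auto simp: bound_def)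
    moreover have "\<alpha> (cell_var t j (h j) (rd y t ! j))"
      using cells[OF j, of "h j"] h[OF j] by (simp add: rd_nth[OF j] bound_def)
    ultimately show ?thesis using heads[OF j] by (auto simp: literal_def ex_less_3 h_def)
  qed
  have seen: "\<alpha> (seen_var t j (st y t) (list_encode (rev (take j (rd y t)))))" if "j \<le> k" for j
    using that
  proof (induction j)
    case 0
    then show ?case using seen0 by simp
  next
    case (Suc j)
    let ?r = "list_encode (rev (take j (rd y t)))"
    have "?r < code_bound"
      using rd_less[of y t] Suc.prems st_le[of y t] set_take_subset[of j "rd y t"]
      by (intro less_code_bound(2)[of "st y t" _ 0]) (auto simp: length_rd)
    then have "\<exists>s<3. lit_true \<alpha> (literal x 5 t j (st y t) ?r (rd y t ! j) s)"
      using Suc.prems t st_le[of y t] rdb[of j] by (intro literal_of_clause sat) (auto simp: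
          bound_def)
    moreover have "rev (take (Suc j) (rd y t)) = rd y t ! j # rev (take j (rd y t))"
      using Suc.prems by (simp add: take_Suc_conv_app_nth length_rd)
    ultimately show ?case using Suc scan[of j] by (auto simp: literal_def ex_less_3)
  qed
  let ?r = "list_encode (rev (rd y t))"
  have all: "\<alpha> (seen_var t k (st y t) ?r)" using seen[of k] by (simp add: length_rd)
  have r: "?r < code_bound"
    using rd_less[of y t] st_le[of y t] by (intro less_code_bound(2)[of
        "st y t" _ 0]) (auto simp: length_rd)
  have b: "t \<le> bound x" "st y t \<le> bound x" "?r \<le> bound x" using t st_le[of y t] r
      by (auto simp: bound_def)
  have state: "\<alpha> (seen_var (Suc t) 0 (st y (Suc t)) 0)"
  proof -
    have "\<exists>s<3. lit_true \<alpha> (literal x 6 t 0 (st y t) ?r 0 s)"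
      using b by (intro literal_of_clause sat) (auto simp: bound_def)
    then show ?thesis using all by (auto simp: literal_def ex_less_3 table_values)
  qed
  have "\<alpha> (head_var (Suc t) j (nat (snd (tp y (Suc t) j) + int (T x)))) \<and>
    (\<forall>c\<le>bound x. \<alpha> (cell_var (Suc t) j c (fst (tp y (Suc t) j) (int c - int (T x)))))" if j:
        "j < k" for j
  proof -
    obtain a d where ad: "snd (transition (st y t) (rd y t)) ! j = (a, d)" by fastforce
    have tp': "tp y (Suc t) j = ((fst (tp y t j))(snd (tp y t j) := a), snd (tp y t j) + offset d)"
      unfolding tp_Suc[OF j] ad by (cases "tp y t j") simp
    have jb: "j \<le> bound x" "h j \<le> bound x" using j h[OF j] by (auto simp: bound_def)
    have head: "\<alpha> (head_var t j (h j))" using heads[OF j] by (simp add: h_def)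
    have "\<exists>s<3. lit_true \<alpha> (literal x 7 t j (h j) (st y t) ?r s)"
      using b jb by (intro literal_of_clause sat) (auto simp: bound_def)
    then have "\<alpha> (head_var (Suc t) j (h j + move (st y t) ?r j - 1))"
      using all head t by (auto simp: literal_def ex_less_3)
    moreover have "h j + move (st y t) ?r j - 1 = nat (snd (tp y (Suc t) j) + int (T x))"
      using h[OF j] table_values(3)[OF j, of y t] ad tp' by simp
    moreover have "\<alpha> (cell_var (Suc t) j c (fst (tp y (Suc t) j) (int c - int (T x))))" if c:
        "c \<le> bound x" for c
    proof (cases "c = h j")
      case True
      have "\<exists>s<3. lit_true \<alpha> (literal x 8 t j (h j) (st y t) ?r s)"
        using b jb by (intro literal_of_clause sat) (auto simp: bound_def)
      then have "\<alpha> (cell_var (Suc t) j (h j) a)"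
        using all head table_values(2)[OF j, of y t] ad by (auto simp: literal_def ex_less_3)
      then show ?thesis using True h[OF j] tp' by simp
    next
      case False
      let ?a = "fst (tp y t j) (int c - int (T x))"
      have "\<exists>s<3. lit_true \<alpha> (literal x 9 t j (h j) c ?a s)"
        using b jb c cell_less[OF j, of y t "int c - int (T x)"]
            by (intro literal_of_clause sat) (auto simp: bound_def)
      then have "\<alpha> (cell_var (Suc t) j c ?a)"
        using head cells[OF j c] False by (auto simp: literal_def ex_less_3)
      then show ?thesis using False h[OF j] tp' by auto
    qed
    ultimately show ?thesis by simp
  qed
  then show ?case using state by blast
qed

text \<open>Index \<open>T x\<close> is tape cell \<open>0\<close>, tape \<open>1\<close> is the
  output, and symbol \<open>1\<close> there stands for the answer \<open>False\<close>, which the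
  clause of kind 10 excludes.\<close>

lemma wit_accepted: "fst (tp (encode_pair x wit) (T x) 1) 0 \<noteq> 1"
proof
  assume *: "fst (tp (encode_pair x wit) (T x) 1) 0 = 1"
  have "\<alpha> (cell_var (T x) 1 (T x) (fst (tp (encode_pair x wit) (T x) 1) (int (T x) - int (T x))))"
  proof -
    have "1 < k" "T x \<le> bound x" using k_ge_2 by (auto simp: bound_def)
    then show ?thesis using run_forced[of "T x"] by blast
  qed
  moreover have "\<exists>s<3. lit_true \<alpha> (literal x 10 0 0 0 0 0 s)"
      by (intro literal_of_clause sat) (auto simp: bound_def)
  ultimately show False using * by (auto simp: literal_def)
qed

end

lemma satisfiable_clause_iff:
  "satisfiable (clause_count x) (clause x) \<longleftrightarrow>
     (\<exists>w. length w \<le> W x \<and> fst (tp (encode_pair x w) (T x) 1) 0 \<noteq> 1)"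
  using satisfiable_if_accepted length_wit wit_accepted unfolding satisfiable_def by metis

subsection \<open>The clauses are definable\<close>

lemma num_W [closure]: "num (\<lambda>x \<rho>. W x)" unfolding W_def by (intro closure)
lemma num_T [closure]: "num (\<lambda>x \<rho>. T x)" unfolding T_def by (intro closure)
lemma num_base [closure]: "num (\<lambda>x \<rho>. base x)" unfolding base_def by (intro closure)
lemma num_bound: "num (\<lambda>x \<rho>. bound x)" unfolding bound_def by (intro closure)

lemma num_clause_count: "num (\<lambda>x \<rho>. clause_count x)"
  unfolding clause_count_def Let_def by (intro closure num_bound)

lemma str_encode_pair_Nil: "str (\<lambda>x \<rho>. encode_pair x [])"
proof -
  have "encode_pair x [] = concat (map (\<lambda>i. True # (if contents x (int i) = 2 then [True] else
      [False])) [0..<length x]) @ [False]" for x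
  proof -
    have "map (\<lambda>b. [True, b]) x = map (\<lambda>i. True # (if contents x (int i) = 2 then [True] else
        [False])) [0..<length x]"
      by (rule nth_equalityI) (auto simp: contents_def)
    then show ?thesis by (simp add: encode_pair_def)
  qed
  then show ?thesis by (simp only:) (intro closure)
qed

lemma num_fixed_input [closure]: "num f \<Longrightarrow> num h \<Longrightarrow> num (\<lambda>x \<rho>. fixed_input x (f x \<rho>) (h x \<rho>))"
  unfolding fixed_input_def by (intro closure num_contents_str str_encode_pair_Nil)

lemma num_vars [closure]:
  "num a \<Longrightarrow> num b \<Longrightarrow> num c \<Longrightarrow> num (\<lambda>x \<rho>. head_var (a x \<rho>) (b x \<rho>) (c x \<rho>))"
  "num a \<Longrightarrow> num b \<Longrightarrow> num c \<Longrightarrow> num d \<Longrightarrow> num (\<lambda>x \<rho>. cell_var (a x \<rho>) (b x \<rho>) (c x \<rho>) (d x \<rho>))"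
  "num a \<Longrightarrow> num b \<Longrightarrow> num c \<Longrightarrow> num (\<lambda>x \<rho>. scan_var (a x \<rho>) (b x \<rho>) (c x \<rho>))"
  "num a \<Longrightarrow> num b \<Longrightarrow> num c \<Longrightarrow> num d \<Longrightarrow> num (\<lambda>x \<rho>. seen_var (a x \<rho>) (b x \<rho>) (c x \<rho>) (d x \<rho>))"
  unfolding var_defs by (intro closure; assumption)+

lemma num_slots [closure]:
  "num a \<Longrightarrow> num b \<Longrightarrow> num c \<Longrightarrow> num s \<Longrightarrow> num (\<lambda>x \<rho>. slots (a x \<rho>) (b x \<rho>) (c x \<rho>) (s x \<rho>))"
  unfolding slots_def by (intro closure)

lemma num_next_state [closure]: "num a \<Longrightarrow> num b \<Longrightarrow> num (\<lambda>x \<rho>. next_state (a x \<rho>) (b x \<rho>))"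
  unfolding next_state_def
  using num_table3[OF _ _ num_const[of 0], of a b code_bound
      "\<lambda>s r _. fst (transition s (rev (list_decode r)))"] .

lemma num_written_symbol [closure]:
  "num a \<Longrightarrow> num b \<Longrightarrow> num c \<Longrightarrow> num (\<lambda>x \<rho>. written_symbol (a x \<rho>) (b x \<rho>) (c x \<rho>))"
  unfolding written_symbol_def
  by (rule num_table3[of a b c code_bound "\<lambda>s r j. fst (snd (transition s (rev (list_decode r))) !
      j)"])

lemma num_move [closure]:
  "num a \<Longrightarrow> num b \<Longrightarrow> num c \<Longrightarrow> num (\<lambda>x \<rho>. move (a x \<rho>) (b x \<rho>) (c x \<rho>))"
  unfolding move_def
  by (rule num_table3[of a b c code_bound "\<lambda>s r j. nat (offset (snd (snd (transition s (rev
      (list_decode r))) ! j)) + 1)"])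

lemma num_clause: "num (\<lambda>x \<rho>. clause x (\<rho> 0) (\<rho> 1))"
  unfolding clause_def literal_def by (intro closure)

lemma polytime_reduction: "polytime (\<lambda>x. cnf_pcp q (clause_count x) (clause x))"
  by (rule polytime_cnf_pcp[OF num_clause_count num_clause])

end

lemma PCP_NP_hard:
  assumes "3 \<le> q"
  shows "NP_hard (PCP_restricted 1 q)"
  unfolding NP_hard_def
proof
  fix L assume "L \<in> class_NP"
  then obtain R and p :: "nat poly" where R: "R \<in> class_P"
    and L: "\<And>x. x \<in> L \<longleftrightarrow> (\<exists>w. length w \<le> poly p (length x) \<and> encode_pair x w \<in> R)"
    unfolding class_NP_def by blast
  from R obtain k g M and r :: "nat poly" where tm: "turing_machine k g M"
    and M: "\<And>y. computes_within k M (poly r (length y)) y [y \<in> R]"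
    unfolding class_P_def polytime_def by blast
  interpret tableau k g M r p by unfold_locales (rule tm)
  have "fst (tp (encode_pair x w) (T x) 1) 0 \<noteq> 1 \<longleftrightarrow> encode_pair x w \<in> R" if "length w \<le> W x" for x w
  proof -
    let ?y = "encode_pair x w"
    obtain ts where ts: "(step M ^^ poly r (length ?y)) (init_config k ?y) = (length M, ts)"
      "fst (ts ! 1) = contents [?y \<in> R]"
      using M[of ?y] unfolding computes_within_def by (auto split: prod.splits)
    \<comment> \<open>Polynomials with natural coefficients are monotone. The fixed time
      \<open>T x\<close> thus lies beyond the halting time for every admissible certificate, and the
      first output symbol is the answer.\<close>
    have "poly r (length ?y) \<le> T x"
      unfolding T_def using that by (intro poly_nat_mono) (simp add: length_encode_pair)
    from funpow_step_halted[OF ts(1) this] have "run ?y (T x) = (length M, ts)"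
        by (simp add: run_def)
    then show ?thesis using ts(2) by (simp add: tp_def contents_def)
  qed
  then have "x \<in> L \<longleftrightarrow> cnf_pcp q (clause_count x) (clause x) \<in> PCP_restricted 1 q" for x
    unfolding L cnf_pcp_in_PCP_iff[OF assms] satisfiable_clause_iff W_def by blast
  then show "polytime_reducible L (PCP_restricted 1 q)"
    unfolding polytime_reducible_def using polytime_reduction by blast
qed

theorem theorem5:
  fixes q :: nat
  assumes "q \<ge> 3"
  shows "NP_complete (PCP_restricted 1 q)"
  unfolding NP_complete_def using PCP_in_NP PCP_NP_hard[OF assms] by blast

end
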